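(* (i) If $p\in[1,\infty)$ and $w\in A_p$, then the operator $f\mapsto\mathbb{M}f$ is of weak $(p,p)$-type with respect to the measure $w$. More precisely, there exists a constant $N$ depending only on $p$, $N_0$, and $[w]_{A_p}$ such that for any $\lambda>0$ and Borel $f\ge0$ we have $$w(\{x:\mathbb{M}f(x)>\lambda\})\le N\lambda^{-p}\int_\Omega f^p\,w(dx).$$ (ii) If $p\in(1,\infty)$ and $w\in A_p$, then $\mathbb{M}$ is a bounded operator in $L_p(w)$, that is, there exists a constant $N$ depending only on $p$, $N_0$, and $[w]_{A_p}$ such that for any $f\in L_p(w)$ we have $$\|\mathbb{M}f\|_{L_p(w)}\le N\|f\|_{L_p(w)}.$$
   Context: Fix integers $d\ge1$ and $k_1,\dots,k_d\ge 1$. Let $\Omega=I_1\times\dots\times I_d\subset\mathbb{R}^d$, where each $I_j$ is either $\mathbb{R}$ or a shifted half-line $[a_j,\infty)$. For $x\in\Omega$, $l>0$ put $$C_{l,x}=x+[0,l^{k_1})\times\dots\times[0,l^{k_d}),\qquad C_l(x)=x+(-l^{k_1}/2,l^{k_1}/2)\times\dots\times(-l^{k_d}/2,l^{k_d}/2).$$ Let $\mathbb{Q}$ be the collection of all $C_l(x)$, $x\in\Omega$, $l>0$, that lie entirely in $\Omega$. $\mu$ is a measure on the Borel subsets of $\Omega$, finite on every $C_{l,x}$, such that: (1) $\lim_{l\to\infty}\mu(C_{l,x})=\infty$ for every $x\in\Omega$; (2) $\mu(\partial\Omega)=0$; (3) $\mu(C_{4l}(x)\cap\Omega)\le N_0\,\mu(C_l(x))$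 for every $C_l(x)\in\mathbb{Q}$, where $N_0$ is a constant. For a Borel set $A$, $f_A=\frac1{\mu(A)}\int_A f\,\mu(dx)$. Weights: let $w$ be a measurable function on $\Omega$ with $0<w<\infty$ $\mu$-a.e. and $w_Q<\infty$ for every $Q\in\mathbb{Q}$. $w$ is an $A_1$-weight if there is a constant $N$ with $w_Q\le Nw(x)$ for all $x\in Q$ and all $Q\in\mathbb{Q}$; the least such $N$ is $[w]_{A_1}$. For $p\in(1,\infty)$, $w$ is an $A_p$-weight if there is a constant $N$ with $w_Q\big((w^{-1/(p-1)})_Q\big)^{p-1}\le N$ for all $Q\in\mathbb{Q}$; the least such $N$ is $[w]_{A_p}$. The symbol $w$ also denotes the measure $w(A)=\int_A w\,\mu(dx)$, and $L_p(w)=L_p(\Omega,w(dx))$. The maximal operator is $\mathbb{M}f(x)=\sup_{Q\in\mathbb{Q},\,Q\ni x}(|f|)_Q$. *)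

theory Defs
  imports "HOL-Analysis.Analysis"
begin

text \<open>
  The dimension \<open>d\<close> is a value rather than a type, so that a constant can be chosen before (hence
  independently of) \<open>d\<close>. Points of \<open>d\<close>-dimensional Euclidean space are the functions
  \<open>nat \<Rightarrow> real\<close> that are \<open>undefined\<close> outside \<open>{..<d}\<close>, i.e. the elements
  of \<open>\<Pi>\<^sub>E j\<in>{..<d}. UNIV\<close>, which is the space of \<open>\<Pi>\<^sub>M j\<in>{..<d}. borel\<close>. Coordinates are
  numbered from 0.
\<close>

definition domain :: "nat \<Rightarrow> (nat \<Rightarrow> real set) \<Rightarrow> (nat \<Rightarrow> real) set" where
  "domain d I = (\<Pi>\<^sub>E j\<in>{..<d}. I j)"

definition corner_box :: "nat \<Rightarrow> (nat \<Rightarrow> nat) \<Rightarrow> real \<Rightarrow> (nat \<Rightarrow> real) \<Rightarrow> (nat \<Rightarrow> real) set" where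
  "corner_box d k l x = (\<Pi>\<^sub>E j\<in>{..<d}. {x j ..< x j + l ^ k j})"

definition centered_box :: "nat \<Rightarrow> (nat \<Rightarrow> nat) \<Rightarrow> real \<Rightarrow> (nat \<Rightarrow> real) \<Rightarrow> (nat \<Rightarrow> real) set" where
  "centered_box d k l x = (\<Pi>\<^sub>E j\<in>{..<d}. {x j - l ^ k j / 2 <..< x j + l ^ k j / 2})"

definition boxes :: "nat \<Rightarrow> (nat \<Rightarrow> nat) \<Rightarrow> (nat \<Rightarrow> real set) \<Rightarrow> (nat \<Rightarrow> real) set set" where
  "boxes d k I =
     {centered_box d k l x | l x. l > 0 \<and> x \<in> domain d I \<and> centered_box d k l x \<subseteq> domain d I}"

definition domain_boundary :: "nat \<Rightarrow> (nat \<Rightarrow> real set) \<Rightarrow> (nat \<Rightarrow> real) set" where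
  "domain_boundary d I = product_topology (\<lambda>_. euclideanreal) {..<d} frontier_of domain d I"

definition admissible ::
    "nat \<Rightarrow> (nat \<Rightarrow> nat) \<Rightarrow> (nat \<Rightarrow> real set) \<Rightarrow> (nat \<Rightarrow> real) measure \<Rightarrow> real \<Rightarrow> bool" where
  "admissible d k I \<mu> N0 \<longleftrightarrow>
     d \<ge> 1 \<and> (\<forall>j<d. k j \<ge> 1) \<and>
     (\<forall>j<d. I j = UNIV \<or> (\<exists>a. I j = {a..})) \<and>
     space \<mu> = domain d I \<and>
     sets \<mu> = sets (restrict_space (\<Pi>\<^sub>M j\<in>{..<d}. (borel :: real measure)) (domain d I)) \<and>
     (\<forall>x\<in>domain d I. \<forall>l>0. emeasure \<mu> (corner_box d k l x) < \<infinity>) \<and>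
     (\<forall>x\<in>domain d I. ((\<lambda>l. emeasure \<mu> (corner_box d k l x)) \<longlongrightarrow> \<infinity>) at_top) \<and>
     domain_boundary d I \<in> null_sets \<mu> \<and>
     (\<forall>x\<in>domain d I. \<forall>l>0. centered_box d k l x \<subseteq> domain d I \<longrightarrow>
        emeasure \<mu> (centered_box d k (4 * l) x \<inter> domain d I)
          \<le> ennreal N0 * emeasure \<mu> (centered_box d k l x))"

text \<open>Real powers on \<open>[0,\<infinity>]\<close>, with \<open>0\<close> to a negative power equal to \<open>\<infinity>\<close>.\<close>

definition ennpowr :: "ennreal \<Rightarrow> real \<Rightarrow> ennreal" where
  "ennpowr x a =
     (if a = 0 then 1
      else if x = 0 then (if a > 0 then 0 else \<infinity>)
      else if x = \<infinity> then (if a > 0 then \<infinity> else 0)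
      else ennreal (enn2real x powr a))"

definition average :: "'a measure \<Rightarrow> 'a set \<Rightarrow> ('a \<Rightarrow> ennreal) \<Rightarrow> ennreal" where
  "average \<mu> A f = (\<integral>\<^sup>+x\<in>A. f x \<partial>\<mu>) / emeasure \<mu> A"

definition is_weight :: "'a measure \<Rightarrow> 'a set set \<Rightarrow> ('a \<Rightarrow> ennreal) \<Rightarrow> bool" where
  "is_weight \<mu> \<Q> w \<longleftrightarrow>
     w \<in> borel_measurable \<mu> \<and> (AE x in \<mu>. 0 < w x \<and> w x < \<infinity>) \<and>
     (\<forall>Q\<in>\<Q>. average \<mu> Q w < \<infinity>)"

definition A_bound ::
    "real \<Rightarrow> 'a measure \<Rightarrow> 'a set set \<Rightarrow> ('a \<Rightarrow> ennreal) \<Rightarrow> real \<Rightarrow> bool" where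
  "A_bound p \<mu> \<Q> w N \<longleftrightarrow>
     (if p = 1 then \<forall>Q\<in>\<Q>. \<forall>x\<in>Q. average \<mu> Q w \<le> ennreal N * w x
      else \<forall>Q\<in>\<Q>. average \<mu> Q w
             * ennpowr (average \<mu> Q (\<lambda>x. ennpowr (w x) (- 1 / (p - 1)))) (p - 1) \<le> ennreal N)"

definition A_weight :: "real \<Rightarrow> 'a measure \<Rightarrow> 'a set set \<Rightarrow> ('a \<Rightarrow> ennreal) \<Rightarrow> bool" where
  "A_weight p \<mu> \<Q> w \<longleftrightarrow> is_weight \<mu> \<Q> w \<and> (\<exists>N. A_bound p \<mu> \<Q> w N)"

definition A_const :: "real \<Rightarrow> 'a measure \<Rightarrow> 'a set set \<Rightarrow> ('a \<Rightarrow> ennreal) \<Rightarrow> real" where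
  "A_const p \<mu> \<Q> w = (LEAST N. A_bound p \<mu> \<Q> w N)"

text \<open>At points lying in no \<open>Q \<in> \<Q>\<close> (boundary points of the domain) the value is \<open>Sup {} = 0\<close>.\<close>

definition maximal :: "'a measure \<Rightarrow> 'a set set \<Rightarrow> ('a \<Rightarrow> real) \<Rightarrow> 'a \<Rightarrow> ennreal" where
  "maximal \<mu> \<Q> f x = (SUP Q\<in>{Q\<in>\<Q>. x \<in> Q}. average \<mu> Q (\<lambda>y. ennreal \<bar>f y\<bar>))"

definition Lp_norm :: "real \<Rightarrow> 'a measure \<Rightarrow> ('a \<Rightarrow> ennreal) \<Rightarrow> ennreal" where
  "Lp_norm p M g = ennpowr (\<integral>\<^sup>+x. ennpowr (g x) p \<partial>M) (1 / p)"

definition Lp_space :: "real \<Rightarrow> 'a measure \<Rightarrow> ('a \<Rightarrow> real) set" where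
  "Lp_space p M = {f \<in> borel_measurable M. Lp_norm p M (\<lambda>x. ennreal \<bar>f x\<bar>) < \<infinity>}"

end

theory Submission
  imports Defs
begin

text \<open>
  Applied to a larger box, the \<open>A_p\<close> inequality shows that the measure \<open>w d\<mu>\<close> inherits the doubling
  property of \<open>\<mu>\<close>, and applied to \<open>f\<close> it bounds \<open>w(Q)\<close> by \<open>\<integral>\<^sub>Q f\<^sup>p w d\<mu>\<close> for
  every box on which the mean of \<open>f\<close> is large; the weak type bound then follows from a Vitali covering
  argument. For the strong type bound reverse Hoelder inequalities are avoided: with
  \<open>\<sigma> = w powr (- 1 / (p - 1))\<close>, Lerner's pointwise estimate bounds \<open>(M f) powr (p - 1)\<close> by a
  multiple of \<open>M_w ((M_\<sigma> (f / \<sigma>)) powr (p - 1) / w)\<close>, where \<open>M_\<nu>\<close> denotes the maximal operator of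
  the measure \<open>\<nu> d\<mu>\<close>. Both \<open>w d\<mu>\<close> and \<open>\<sigma> d\<mu>\<close> are doubling, so the unweighted maximal theorem
  applies to each, in \<open>L_q\<close> with \<open>q = p / (p - 1)\<close> and in \<open>L_p\<close> respectively.
\<close>

section \<open>Powers on the extended half-line\<close>

text \<open>The obstacle is the boundary. The \<open>A_p\<close> inequality speaks only of boxes
  inside the domain, so the enlarged box of the covering argument must again be one, and a
  concentric dilation near a face is not; enlargements are therefore shifted inwards. What the
  analysis uses about boxes is collected in \<open>doubling_basis\<close>, whose sets, sizes and
  enlargements stay fixed while the measure varies among \<mu>, w d\<mu> and \<sigma> d\<mu>.
  Geometry reaches the constants only through \<open>D = N0^2\<close>, so they depend on neither
  \<open>d\<close> nor \<open>k\<close>. Lerner's estimate rests on an identity for a box Q. Let m,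
  W, S be its measures under \<mu>, w d\<mu>, \<sigma> d\<mu>, and A the \<mu>-integral of f over Q.
  Then (A/m)^(p-1) = [W S^(p-1) / m^p] (m/W) (A/S)^(p-1). The bracket is at most the
  \<open>A_p\<close> constant. Since A/S is the \<sigma>-average of f/\<sigma>, it is below
  M_\<sigma>(f/\<sigma>) on all of Q, and the remaining product is at most a w-average.\<close>

lemma ennreal_cases_pos:
  fixes x :: ennreal
  obtains (zero) "x = 0" | (pos) r where "r > 0" "x = ennreal r" | (top) "x = top"
  by (cases x) (force simp: less_le)+

lemma ennpowr_ennreal_pos: "r > 0 \<Longrightarrow> ennpowr (ennreal r) a = ennreal (r powr a)"
  by (auto simp: ennpowr_def)

lemma ennpowr_ennreal: "r \<ge> 0 \<Longrightarrow> a > 0 \<Longrightarrow> ennpowr (ennreal r) a = ennreal (r powr a)"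
  by (cases "r = 0") (auto simp: ennpowr_def)

lemma ennpowr_0: "a > 0 \<Longrightarrow> ennpowr 0 a = 0"
  and ennpowr_0_neg: "a < 0 \<Longrightarrow> ennpowr 0 a = top"
  and ennpowr_top: "a > 0 \<Longrightarrow> ennpowr top a = top"
  and ennpowr_top_neg: "a < 0 \<Longrightarrow> ennpowr top a = 0"
  by (auto simp: ennpowr_def)

lemmas ennpowr_simps =
  ennpowr_ennreal_pos ennpowr_0 ennpowr_0_neg ennpowr_top ennpowr_top_neg

lemma ennpowr_one: "ennpowr x 1 = x"
  by (cases x rule: ennreal_cases_pos) (auto simp: ennpowr_simps)

lemma ennpowr_base_1: "ennpowr 1 a = 1"
  by (auto simp: ennpowr_def)

lemma ennpowr_mono:
  assumes "a > 0" "x \<le> y" shows "ennpowr x a \<le> ennpowr y a"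
  using assms
  by (cases x rule: ennreal_cases_pos; cases y rule: ennreal_cases_pos)
     (auto simp: ennpowr_simps top_unique intro!: ennreal_leI powr_mono2)

text \<open>A negative exponent breaks the rule at \<open>0 * top\<close>: the left side is then
  \<open>top\<close>, the right side \<open>top * 0 = 0\<close>.\<close>

lemma ennpowr_mult:
  assumes "a > 0" shows "ennpowr (x * y) a = ennpowr x a * ennpowr y a"
  using assms
  by (cases x rule: ennreal_cases_pos; cases y rule: ennreal_cases_pos)
     (auto simp: ennpowr_simps ennreal_mult[symmetric] powr_mult ennreal_mult_top ennreal_top_mult)

lemma ennpowr_ennpowr:
  assumes "a \<noteq> 0" "b \<noteq> 0" shows "ennpowr (ennpowr x a) b = ennpowr x (a * b)"
proof -
  have "a < 0 \<or> a > 0" "b < 0 \<or> b > 0" using assms by auto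
  then show ?thesis
    by (cases x rule: ennreal_cases_pos)
       (auto simp: ennpowr_simps powr_powr mult_neg_neg mult_pos_neg mult_neg_pos)
qed

lemma ennpowr_add:
  assumes "a > 0" "b > 0" shows "ennpowr x (a + b) = ennpowr x a * ennpowr x b"
  using assms
  by (cases x rule: ennreal_cases_pos)
     (auto simp: ennpowr_simps ennreal_mult[symmetric] powr_add)

lemma ennpowr_less_top: "x < top \<Longrightarrow> 0 < x \<or> a > 0 \<Longrightarrow> ennpowr x a < top"
  by (cases x rule: ennreal_cases_pos) (auto simp: ennpowr_simps)

lemma ennpowr_pos: "0 < x \<Longrightarrow> x < top \<or> a > 0 \<Longrightarrow> 0 < ennpowr x a"
  by (cases x rule: ennreal_cases_pos) (auto simp: ennpowr_simps)

lemma ennpowr_eq_top_iff: "a > 0 \<Longrightarrow> ennpowr x a = top \<longleftrightarrow> x = top"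
  by (cases x rule: ennreal_cases_pos) (auto simp: ennpowr_simps)

lemma ennpowr_divide:
  assumes "a > 0" "0 < y" "y < top"
  shows "ennpowr (x / y) a = ennpowr x a / ennpowr y a"
  using assms
  by (cases x rule: ennreal_cases_pos; cases y rule: ennreal_cases_pos)
     (auto simp: ennpowr_simps divide_ennreal powr_divide ennreal_top_divide)

lemma measurable_ennpowr [measurable]: "(\<lambda>x. ennpowr x a) \<in> borel_measurable borel"
  unfolding ennpowr_def by measurable

text \<open>Young's inequality with the second factor fixed gives Jensen's inequality as soon as that
  factor is the mean.\<close>

lemma Young_tangent:
  fixes x c p :: real
  assumes "p > 1" "x \<ge> 0" "c > 0"
  shows "x * c powr (p - 1) \<le> x powr p / p + (1 - 1 / p) * c powr p"
proof -
  have "x * c powr (p - 1) \<le> x powr p / p + (c powr (p - 1)) powr (p / (p - 1)) / (p / (p - 1))"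
    using assms by (intro Youngs_inequality) (auto simp: field_simps)
  also have "(c powr (p - 1)) powr (p / (p - 1)) = c powr p"
    using assms by (simp add: powr_powr)
  finally show ?thesis using assms by (simp add: field_simps)
qed

lemma ennpowr_Young_tangent:
  assumes "p > 1" "c > 0"
  shows "x * ennreal (c powr (p - 1)) \<le> ennreal (1 / p) * ennpowr x p + ennreal ((1 - 1 / p) * c powr p)"
proof (cases x rule: ennreal_cases_pos)
  case (pos r)
  have "ennreal (r * c powr (p - 1)) \<le> ennreal (r powr p / p + (1 - 1 / p) * c powr p)"
    using Young_tangent[of p r c] assms pos by (intro ennreal_leI) auto
  then show ?thesis using assms pos
    by (simp add: ennpowr_simps ennreal_mult[symmetric] ennreal_plus[symmetric] del: ennreal_plus)
qed (use assms in \<open>auto simp: ennpowr_simps ennreal_mult_top\<close>)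

text \<open>The measure is not normalised: the factor with exponent \<open>p - 1\<close> keeps null
  measures in scope and is the power of \<sigma>(Q) that occurs in the \<open>A_p\<close>
  condition.\<close>

lemma Jensen_ennpowr:
  assumes p: "p > 1" and F[measurable]: "F \<in> borel_measurable N" and S: "emeasure N (space N) < top"
  shows "ennpowr (\<integral>\<^sup>+x. F x \<partial>N) p \<le> (\<integral>\<^sup>+x. ennpowr (F x) p \<partial>N) * ennpowr (emeasure N (space N)) (p - 1)"
    (is "ennpowr ?A p \<le> ?B * ennpowr ?S (p - 1)")
proof (cases "?S = 0 \<or> ?A = 0")
  case True
  then have "?A = 0"
    using nn_integral_null_measure by (metis nn_integral_empty emeasure_0_AE nn_integral_0_iff_AE F AE_mp eventually_mono)
  then show ?thesis using p by (simp add: ennpowr_simps)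
next
  case False
  then obtain s where s: "?S = ennreal s" "s > 0" using S
    by (cases ?S rule: ennreal_cases_pos) auto
  show ?thesis
  proof (cases ?A rule: ennreal_cases_pos)
    case zero then show ?thesis using False by simp
  next
    case top
    \<comment> \<open>With finite mass, an infinite integral forces an infinite right-hand side,
      because x exceeds x^p by at most 1.\<close>
    have "x \<le> 1 + ennpowr x p" for x :: ennreal
    proof (cases "x \<le> 1")
      case False
      then have "ennpowr x 1 \<le> ennpowr x p"
        using p powr_mono[of 1 p "enn2real x"]
        by (cases x rule: ennreal_cases_pos) (auto simp: ennpowr_simps intro!: ennreal_leI)
      then show ?thesis by (simp add: ennpowr_one add_increasing)
    qed (simp add: add_increasing2)
    then have "?A \<le> (\<integral>\<^sup>+x. 1 + ennpowr (F x) p \<partial>N)" by (intro nn_integral_mono)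
    also have "\<dots> = ?S + ?B" by (subst nn_integral_add) auto
    finally have "?B = top" using top S by (auto simp: top_unique)
    then show ?thesis using False s p by (simp add: ennpowr_simps ennreal_top_mult)
  next
    case (pos a)
    define c where "c = a / s"
    have c: "c > 0" using pos s by (simp add: c_def)
    \<comment> \<open>For this \<open>c\<close> the constant term of the tangent estimate integrates
      to the fraction 1 - 1/p of the left-hand side and can be absorbed.\<close>
    have cs: "c powr p * s = a * c powr (p - 1)"
      using c s p by (simp add: powr_diff c_def field_simps)
    have "ennreal (a * c powr (p - 1)) = (\<integral>\<^sup>+x. F x * ennreal (c powr (p - 1)) \<partial>N)"
      using pos by (simp add: nn_integral_multc ennreal_mult)
    also have "\<dots> \<le> (\<integral>\<^sup>+x. ennreal (1 / p) * ennpowr (F x) p + ennreal ((1 - 1 / p) * c powr p) \<partial>N)"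
      using ennpowr_Young_tangent[OF p c] by (intro nn_integral_mono)
    also have "\<dots> = ennreal (1 / p) * ?B + ennreal ((1 - 1 / p) * (a * c powr (p - 1)))"
      using p s cs by (subst nn_integral_add)
        (auto simp: nn_integral_cmult ennreal_mult[symmetric] mult.assoc)
    finally have *: "ennreal (a * c powr (p - 1)) \<le> ennreal (1 / p) * ?B + ennreal ((1 - 1 / p) * (a * c powr (p - 1)))" .
    have "ennreal (a * c powr (p - 1)) \<le> ?B"
    proof (cases ?B)
      case (real b)
      have "a * c powr (p - 1) \<le> 1 / p * b + (1 - 1 / p) * (a * c powr (p - 1))"
        using * real p pos
        by (simp add: ennreal_mult[symmetric] ennreal_plus[symmetric] del: ennreal_plus)
      then have "a * c powr (p - 1) \<le> b" using p by (simp add: field_simps)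
      then show ?thesis using real by (simp add: ennreal_leI)
    qed simp
    then have "ennreal (a * c powr (p - 1)) * ennpowr ?S (p - 1) \<le> ?B * ennpowr ?S (p - 1)"
      by (intro mult_right_mono) auto
    moreover have "a * c powr (p - 1) * s powr (p - 1) = a powr p"
      using pos s p by (simp add: c_def powr_divide powr_diff)
    ultimately show ?thesis using pos s p
      by (simp add: ennpowr_simps ennreal_mult[symmetric])
  qed
qed

lemma ennreal_mult_divide_cancel: "y \<noteq> 0 \<Longrightarrow> y \<noteq> top \<Longrightarrow> y * (x / y) = (x::ennreal)"
  by (simp add: ennreal_times_divide mult.commute[of y] mult_divide_eq_ennreal)

lemma ennpowr_le_iff:
  assumes "a > 0" shows "ennpowr x a \<le> y \<longleftrightarrow> x \<le> ennpowr y (1 / a)"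
proof
  assume "ennpowr x a \<le> y"
  then have "ennpowr (ennpowr x a) (1 / a) \<le> ennpowr y (1 / a)" using assms by (intro ennpowr_mono) auto
  then show "x \<le> ennpowr y (1 / a)" using assms by (simp add: ennpowr_ennpowr ennpowr_one)
next
  assume "x \<le> ennpowr y (1 / a)"
  then have "ennpowr x a \<le> ennpowr (ennpowr y (1 / a)) a" using assms by (intro ennpowr_mono) auto
  then show "ennpowr x a \<le> y" using assms by (simp add: ennpowr_ennpowr ennpowr_one)
qed

lemma ennpowr_indicator: "a > 0 \<Longrightarrow> ennpowr (indicator A x) a = indicator A x"
  by (simp add: indicator_def ennpowr_0 ennpowr_base_1)

text \<open>The least constant exists only because some right-hand side is finite where the left-hand
  side is positive: this bounds all constants away from \<open>0\<close>, which matters where \<open>Y = top\<close>.\<close>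

lemma Least_constant:
  fixes X Y :: "'i \<Rightarrow> ennreal"
  assumes ex: "\<exists>N::real. \<forall>i\<in>J. X i \<le> ennreal N * Y i"
    and base: "base \<in> J" "0 < X base" "Y base < top"
  defines "L \<equiv> (LEAST N::real. \<forall>i\<in>J. X i \<le> ennreal N * Y i)"
  shows "\<forall>i\<in>J. X i \<le> ennreal L * Y i"
proof -
  define S where "S = {N::real. \<forall>i\<in>J. X i \<le> ennreal N * Y i}"
  obtain N1 where N1: "N1 \<in> S" using ex by (auto simp: S_def)
  obtain y where y: "Y base = ennreal y" "y \<ge> 0" using base(3) by (cases "Y base") auto
  have "X base \<le> ennreal N1 * Y base" using N1 base(1) by (auto simp: S_def)
  then have "X base < top" using y by (auto simp: ennreal_mult_less_top less_top[symmetric] top_unique ennreal_mult_eq_top_iff)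
  then obtain x where x: "X base = ennreal x" "x > 0" using base(2) by (cases "X base" rule: ennreal_cases_pos) auto
  have low: "0 < N" "x \<le> N * y" if "N \<in> S" for N
  proof -
    have *: "ennreal x \<le> ennreal N * ennreal y" using that base(1) x y by (auto simp: S_def)
    show "0 < N"
    proof (rule ccontr)
      assume "\<not> 0 < N"
      then show False using * x by (simp add: ennreal_neg)
    qed
    then show "x \<le> N * y" using * y x by (simp add: ennreal_mult[symmetric])
  qed
  have y0: "y > 0" using low[OF N1] x y by (cases "y = 0") auto
  define m where "m = Inf S"
  have "x / y \<le> m" unfolding m_def using N1 low y0 by (intro cInf_greatest) (auto simp: field_simps)
  then have m: "m > 0" using x y0 by (smt (verit) divide_pos_pos)
  have bdd: "bdd_below S" using low by (intro bdd_belowI[of _ 0]) (auto intro: less_imp_le)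
  \<comment> \<open>The infimum inherits the inequality index by index: \<open>Y i = top\<close>
    uses that \<open>m\<close> is positive, and a finite positive \<open>Y i\<close> can be divided
    out.\<close>
  have mS: "X i \<le> ennreal m * Y i" if i: "i \<in> J" for i
  proof (cases "Y i" rule: ennreal_cases_pos)
    case zero then show ?thesis using N1 i by (force simp: S_def)
  next
    case top then show ?thesis using m by (simp add: ennreal_mult_top)
  next
    case (pos b)
    have le: "X i \<le> ennreal (N * b)" if "N \<in> S" for N
      using that i pos low[OF that] by (auto simp: S_def ennreal_mult)
    then have "X i < top" using N1 by (metis ennreal_less_top le_less_trans)
    then obtain a where a: "X i = ennreal a" "a \<ge> 0" by (cases "X i") auto
    have "a / b \<le> m" unfolding m_def
    proof (intro cInf_greatest)
      fix N assume "N \<in> S"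
      then have "a \<le> N * b" using le[of N] a pos low(1)[of N] by simp
      then show "a / b \<le> N" using pos by (simp add: field_simps)
    qed (use N1 in auto)
    then have "a \<le> m * b" using pos by (simp add: field_simps)
    then show ?thesis using a pos m by (simp add: ennreal_mult[symmetric] ennreal_leI)
  qed
  have "L = m" unfolding L_def
  proof (rule Least_equality)
    show "\<forall>i\<in>J. X i \<le> ennreal m * Y i" using mS by auto
    show "m \<le> N" if "\<forall>i\<in>J. X i \<le> ennreal N * Y i" for N
      unfolding m_def using that bdd by (intro cInf_lower) (auto simp: S_def)
  qed
  then show ?thesis using mS by simp
qed

lemma set_nn_integral_pos:
  assumes [measurable]: "g \<in> borel_measurable M" "A \<in> sets M"
    and pos: "AE x in M. 0 < g x" and A: "emeasure M A \<noteq> 0"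
  shows "0 < (\<integral>\<^sup>+x\<in>A. g x \<partial>M)"
proof (rule ccontr)
  assume "\<not> ?thesis"
  then have "AE x in M. g x * indicator A x = 0" by (subst nn_integral_0_iff_AE[symmetric]) auto
  with pos have "AE x in M. x \<notin> A" by eventually_elim (auto simp: indicator_def split: if_splits)
  then have "emeasure M {x \<in> space M. x \<in> A} = 0" by (rule emeasure_eq_0_AE)
  moreover have "{x \<in> space M. x \<in> A} = A" using sets.sets_into_space[OF assms(2)] by blast
  ultimately show False using A by simp
qed

lemma set_nn_integral_null:
  assumes [measurable]: "g \<in> borel_measurable M" "A \<in> sets M" and "emeasure M A = 0"
  shows "(\<integral>\<^sup>+x\<in>A. g x \<partial>M) = 0"
  using assms by (intro nn_integral_null_set) auto

section \<open>Maximal operators over doubling families of sets\<close>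

text \<open>Extended-valued arguments allow the operators to be composed: the inner one is divided
  by \<open>w\<close>, and the result may be infinite.\<close>

definition maximal_op :: "'a measure \<Rightarrow> 'a set set \<Rightarrow> ('a \<Rightarrow> ennreal) \<Rightarrow> 'a \<Rightarrow> ennreal" where
  "maximal_op N \<Q> g x = (SUP Q\<in>{Q\<in>\<Q>. x \<in> Q}. average N Q g)"

lemma maximal_eq_maximal_op: "maximal N \<Q> f = maximal_op N \<Q> (\<lambda>x. ennreal \<bar>f x\<bar>)"
  by (simp add: maximal_def maximal_op_def fun_eq_iff)

lemma average_le_maximal_op: "Q \<in> \<Q> \<Longrightarrow> x \<in> Q \<Longrightarrow> average N Q g \<le> maximal_op N \<Q> g x"
  unfolding maximal_op_def by (intro SUP_upper) auto

lemma less_average_imp: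
  assumes "c < average N Q g" "emeasure N Q < top"
  shows "c * emeasure N Q \<le> (\<integral>\<^sup>+x\<in>Q. g x \<partial>N)"
proof (cases "emeasure N Q = 0")
  case False
  have "c * emeasure N Q \<le> average N Q g * emeasure N Q"
    using assms by (intro mult_right_mono) auto
  also have "\<dots> = (\<integral>\<^sup>+x\<in>Q. g x \<partial>N)"
    using False assms unfolding average_def
    by (simp add: ennreal_divide_times)
  finally show ?thesis .
qed simp

section \<open>Dyadic level sums for powers\<close>

lemma ennpowr_le_dyadic_sum:
  assumes "p > 0"
  shows "ennpowr x p \<le> (\<integral>\<^sup>+n. (if ennreal (2 powr (real_of_int n + 1)) < x then ennreal (2 powr ((real_of_int n + 2) * p)) else 0)
           \<partial>count_space (UNIV::int set))" (is "_ \<le> (\<integral>\<^sup>+n. ?h n \<partial>_)")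
proof (cases x rule: ennreal_cases_pos)
  case zero then show ?thesis using assms by (simp add: ennpowr_simps)
next
  case (pos r)
  \<comment> \<open>The lower bound 2^(n+1) < r activates term n, and r <= 2^(n+2) makes this single
    term suffice. The threshold is twice 2^n to match the level \<open>2 * s\<close> of the weak
    type bound.\<close>
  define n where "n = \<lceil>log 2 r\<rceil> - 2"
  have "n + 1 < log 2 r" "log 2 r \<le> n + 2" unfolding n_def by linarith+
  then have n: "2 powr (real_of_int n + 1) < r" "r \<le> 2 powr (n + 2)"
    using pos by (simp_all add: less_log_iff log_le_iff)
  have "r powr p \<le> (2 powr (n + 2)) powr p" using n pos assms by (intro powr_mono2) auto
  then have "ennpowr x p \<le> ?h n"
    using n pos by (simp add: ennpowr_simps powr_powr ennreal_leI ennreal_less_iff)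
  also have "\<dots> \<le> (\<integral>\<^sup>+n. ?h n \<partial>count_space (UNIV::int set))" by (rule nn_integral_ge_point) simp
  finally show ?thesis .
next
  case top
  \<comment> \<open>Every term is active here, and those with n >= 0 are at least 1.\<close>
  have "top = (\<integral>\<^sup>+n. indicator {0::int..} n \<partial>count_space (UNIV::int set))"
    by (simp add: infinite_Ici)
  also have "\<dots> \<le> (\<integral>\<^sup>+n. ?h n \<partial>count_space (UNIV::int set))"
    using top assms by (intro nn_integral_mono) (auto simp: indicator_def ge_one_powr_ge_zero intro!: ennreal_leI[of 1, simplified])
  finally show ?thesis by (simp add: top_unique)
qed

text \<open>The active terms form a geometric series running downwards from the largest power of 2
  not exceeding x, with ratio 2^(-a); its sum gives the constant.\<close>

lemma dyadic_sum_le_ennpowr: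
  assumes "a > 0"
  shows "(\<integral>\<^sup>+n. (if ennreal (2 powr real_of_int n) < x then ennreal (2 powr (real_of_int n * a)) else 0) \<partial>count_space (UNIV::int set))
           \<le> ennreal (1 / (1 - 2 powr - a)) * ennpowr x a" (is "(\<integral>\<^sup>+n. ?h n \<partial>_) \<le> ?C * _")
proof -
  have r1: "2 powr - a < 1" using assms by (simp add: powr_less_one)
  show ?thesis
  proof (cases x rule: ennreal_cases_pos)
    case zero then show ?thesis by simp
  next
    case (pos r)
    define N where "N = \<lfloor>log 2 r\<rfloor>"
    have N: "2 powr N \<le> r" using pos by (simp add: N_def powr_le_iff)
    have bound: "n \<le> N" if "ennreal (2 powr real_of_int n) < x" for n :: int
    proof -
      have "2 powr n < r" using that pos by (simp add: ennreal_less_iff)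
      then have "n < log 2 r" using pos by (simp add: less_log_iff)
      then show ?thesis unfolding N_def by linarith
    qed
    have "(\<integral>\<^sup>+n. ?h n \<partial>count_space (UNIV::int set)) \<le> (\<integral>\<^sup>+n. ennreal (2 powr (real_of_int n * a)) * indicator {..N} n \<partial>count_space (UNIV::int set))"
      using bound by (intro nn_integral_mono) (auto simp: indicator_def)
    also have "\<dots> = (\<integral>\<^sup>+n. ennreal (2 powr (real_of_int n * a)) \<partial>count_space {..N})"
      by (simp add: nn_integral_count_space_indicator)
    also have "\<dots> = (\<integral>\<^sup>+i. ennreal (2 powr ((N - int i) * a)) \<partial>count_space (UNIV::nat set))"
    proof -
      have "bij_betw (\<lambda>i. N - int i) UNIV {..N}"
        by (rule bij_betwI[where g = "\<lambda>n. nat (N - n)"]) auto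
      from nn_integral_bij_count_space[OF this, of "\<lambda>n. ennreal (2 powr (real_of_int n * a))"]
      show ?thesis by simp
    qed
    also have "\<dots> = (\<Sum>i. ennreal (2 powr (N * a) * (2 powr - a) ^ i))"
    proof -
      have "2 powr ((N - int i) * a) = 2 powr (N * a) * (2 powr - a) ^ i" for i
        by (simp add: powr_realpow[symmetric] powr_powr powr_add[symmetric] algebra_simps)
      then show ?thesis by (simp add: nn_integral_count_space_nat)
    qed
    also have "\<dots> = ennreal (2 powr (N * a) * (1 / (1 - 2 powr - a)))"
      using r1 by (intro suminf_ennreal_eq sums_mult geometric_sums) auto
    also have "\<dots> \<le> ennreal (r powr a * (1 / (1 - 2 powr - a)))"
    proof (intro ennreal_leI mult_right_mono)
      have "(2 powr N) powr a \<le> r powr a" using N assms by (intro powr_mono2) auto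
      then show "2 powr (N * a) \<le> r powr a" by (simp add: powr_powr)
    qed (use r1 in auto)
    also have "\<dots> = ?C * ennpowr x a"
      using pos r1 by (simp add: ennpowr_simps ennreal_mult[symmetric] mult.commute)
    finally show ?thesis .
  next
    case top then show ?thesis using assms r1 by (simp add: ennpowr_simps ennreal_mult_top)
  qed
qed

text \<open>The enlargement \<open>star Q\<close> belongs to the family, so conditions on its
  members apply to it. Only \<open>emeasure\<close> and \<open>D\<close> change when a density is
  introduced. The Lindelof property makes arbitrary unions measurable.\<close>

locale doubling_basis =
  fixes M :: "'a measure" and \<Q> :: "'a set set" and size :: "'a set \<Rightarrow> real"
    and star :: "'a set \<Rightarrow> 'a set" and D :: ennreal
  assumes basis_sets: "\<Q> \<subseteq> sets M"
    and countable_subcover: "\<A> \<subseteq> \<Q> \<Longrightarrow> \<exists>\<C>\<subseteq>\<A>. countable \<C> \<and> \<Union>\<C> = \<Union>\<A>"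
    and star_basis: "Q \<in> \<Q> \<Longrightarrow> star Q \<in> \<Q>"
    and meets_subset_star:
      "Q \<in> \<Q> \<Longrightarrow> Q' \<in> \<Q> \<Longrightarrow> size Q' \<le> size Q \<Longrightarrow> Q \<inter> Q' \<noteq> {} \<Longrightarrow> Q' \<subseteq> star Q"
    and finite_basis: "Q \<in> \<Q> \<Longrightarrow> emeasure M Q < top"
    and doubling: "Q \<in> \<Q> \<Longrightarrow> emeasure M (star Q) \<le> D * emeasure M Q"
begin

section \<open>Vitali covering and the maximal operator of a doubling measure\<close>

lemma sets_basis [measurable]: "Q \<in> \<Q> \<Longrightarrow> Q \<in> sets M"
  using basis_sets by auto

lemma subset_star: "Q \<in> \<Q> \<Longrightarrow> Q \<subseteq> star Q"
  using meets_subset_star[of Q Q] by auto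

lemma sets_Union_basis:
  assumes "\<A> \<subseteq> \<Q>" shows "\<Union>\<A> \<in> sets M"
proof -
  obtain \<C> where "\<C> \<subseteq> \<A>" "countable \<C>" "\<Union>\<C> = \<Union>\<A>" using countable_subcover[OF assms] by auto
  then show ?thesis using assms basis_sets by (metis sets.countable_Union subset_trans)
qed

text \<open>Greedy choice: a set of largest size absorbs into its star everything it meets, and the
  induction continues with the sets disjoint from it, possibly many fewer.\<close>

lemma finite_Vitali:
  assumes "finite \<A>" "\<A> \<subseteq> \<Q>"
  shows "\<exists>\<B>\<subseteq>\<A>. disjoint \<B> \<and> \<Union>\<A> \<subseteq> \<Union>(star ` \<B>)"
  using assms
proof (induction \<A> rule: finite_psubset_induct)
  case (psubset \<A>)
  show ?case
  proof (cases "\<A> = {}")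
    case False
    then have "Max (size ` \<A>) \<in> size ` \<A>" using psubset.hyps by (intro Max_in) auto
    then obtain Q where "Q \<in> \<A>" "size Q = Max (size ` \<A>)" by auto
    then have Q: "Q \<in> \<A>" "\<And>Q'. Q' \<in> \<A> \<Longrightarrow> size Q' \<le> size Q"
      using psubset.hyps by auto
    let ?A = "{Q' \<in> \<A> - {Q}. Q \<inter> Q' = {}}"
    obtain \<B> where B: "\<B> \<subseteq> ?A" "disjoint \<B>" "\<Union>?A \<subseteq> \<Union>(star ` \<B>)"
      using psubset.IH[of ?A] psubset.prems Q by blast
    have "Q' \<subseteq> \<Union>(star ` insert Q \<B>)" if "Q' \<in> \<A>" for Q'
    proof (cases "Q' = Q \<or> Q \<inter> Q' \<noteq> {}")
      case True
      then have "Q' \<subseteq> star Q"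
        using that Q psubset.prems subset_star meets_subset_star by blast
      then show ?thesis by auto
    next
      case False
      then have "Q' \<subseteq> \<Union>(star ` \<B>)" using that B(3) by blast
      then show ?thesis by auto
    qed
    then have "\<Union>\<A> \<subseteq> \<Union>(star ` insert Q \<B>)" by (rule Union_least)
    moreover have "disjoint (insert Q \<B>)"
      using B(1,2) unfolding disjoint_def by blast
    ultimately show ?thesis using B(1) Q(1) by (intro exI[of _ "insert Q \<B>"]) blast
  qed auto
qed

text \<open>Sizes in \<open>\<A>\<close> may be unbounded, but a finite subfamily always has a
  largest member. The estimate is uniform over finite subfamilies, so Lindelof and continuity from
  below carry it to the whole union.\<close>

lemma emeasure_Union_le:
  assumes A: "\<A> \<subseteq> \<Q>" and g[measurable]: "g \<in> borel_measurable M"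
    and le: "\<And>Q. Q \<in> \<A> \<Longrightarrow> emeasure M Q \<le> (\<integral>\<^sup>+x\<in>Q. g x \<partial>M)"
  shows "emeasure M (\<Union>\<A>) \<le> D * (\<integral>\<^sup>+x. g x \<partial>M)"
proof -
  have fin: "emeasure M (\<Union>\<F>) \<le> D * (\<integral>\<^sup>+x. g x \<partial>M)" if F: "finite \<F>" "\<F> \<subseteq> \<A>" for \<F>
  proof -
    obtain \<B> where B: "\<B> \<subseteq> \<F>" "disjoint \<B>" "\<Union>\<F> \<subseteq> \<Union>(star ` \<B>)"
      using finite_Vitali[OF F(1) subset_trans[OF F(2) A]] by (elim exE conjE)
    have finB: "finite \<B>" and BQ: "\<B> \<subseteq> \<Q>" and BA: "\<B> \<subseteq> \<A>"
      using B F A by (auto intro: finite_subset)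
    have [measurable]: "B \<in> sets M" if "B \<in> \<B>" for B using that BQ basis_sets by auto
    have "emeasure M (\<Union>\<F>) \<le> emeasure M (\<Union>B\<in>\<B>. star B)"
      using B finB BQ star_basis basis_sets by (intro emeasure_mono sets.finite_UN) auto
    also have "\<dots> \<le> (\<Sum>B\<in>\<B>. emeasure M (star B))"
      using finB BQ star_basis basis_sets by (intro emeasure_subadditive_finite) auto
    also have "\<dots> \<le> (\<Sum>B\<in>\<B>. D * (\<integral>\<^sup>+x\<in>B. g x \<partial>M))"
      using BQ BA by (intro sum_mono order.trans[OF doubling] mult_left_mono le) auto
    also have "\<dots> = D * (\<integral>\<^sup>+x. (\<Sum>B\<in>\<B>. g x * indicator B x) \<partial>M)"
      by (subst nn_integral_sum) (auto simp: sum_distrib_left)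
    also have "(\<integral>\<^sup>+x. (\<Sum>B\<in>\<B>. g x * indicator B x) \<partial>M) = (\<integral>\<^sup>+x\<in>\<Union>\<B>. g x \<partial>M)"
    proof (intro nn_integral_cong)
      fix x
      have "disjoint_family_on (\<lambda>B. B) \<B>"
        using B(2) by (auto simp: disjoint_family_on_def disjoint_def)
      then have "indicator (\<Union>B\<in>\<B>. B) x = (\<Sum>B\<in>\<B>. indicator B x :: ennreal)"
        using finB by (rule indicator_UN_disjoint[rotated])
      then show "(\<Sum>B\<in>\<B>. g x * indicator B x) = g x * indicator (\<Union>\<B>) x"
        by (simp add: sum_distrib_left)
    qed
    also have "D * \<dots> \<le> D * (\<integral>\<^sup>+x. g x \<partial>M)"
      by (intro mult_left_mono nn_integral_mono) (auto simp: indicator_def)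
    finally show ?thesis .
  qed
  obtain \<C> where C: "\<C> \<subseteq> \<A>" "countable \<C>" "\<Union>\<C> = \<Union>\<A>" using countable_subcover[OF A] by auto
  show ?thesis
  proof (cases "\<C> = {}")
    case False
    define U where "U n = \<Union>(from_nat_into \<C> ` {..n})" for n :: nat
    have in_C: "from_nat_into \<C> n \<in> \<C>" for n using False by (rule from_nat_into)
    have "(SUP n. emeasure M (U n)) = emeasure M (\<Union>n. U n)"
    proof (rule SUP_emeasure_incseq)
      show "range U \<subseteq> sets M"
        using in_C C(1) A basis_sets unfolding U_def by (auto intro!: sets.finite_UN)
      show "incseq U" by (auto simp: U_def incseq_def) (meson atMost_iff le_trans)
    qed
    moreover have "(\<Union>n. U n) = \<Union>(range (from_nat_into \<C>))"
      unfolding U_def by blast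
    then have "(\<Union>n. U n) = \<Union>\<C>"
      unfolding range_from_nat_into[OF False C(2)] .
    moreover have "emeasure M (U n) \<le> D * (\<integral>\<^sup>+x. g x \<partial>M)" for n
      unfolding U_def using in_C C(1) by (intro fin) auto
    ultimately show ?thesis using C(3) by (metis SUP_least)
  next
    case True
    then have "\<Union>\<A> = {}" using C by simp
    then show ?thesis by (simp only: emeasure_empty zero_le)
  qed
qed

text \<open>Strict superlevel sets thus become inputs for the covering estimate, and the maximal
  function is measurable.\<close>

lemma superlevel_maximal_op:
  "{x \<in> space M. t < maximal_op N \<Q> g x} = \<Union>{Q \<in> \<Q>. t < average N Q g}"
proof -
  have "Q \<subseteq> space M" if "Q \<in> \<Q>" for Q using that sets_basis sets.sets_into_space by blast
  then show ?thesis unfolding maximal_op_def less_SUP_iff by blast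
qed

lemma measurable_maximal_op [measurable]: "maximal_op N \<Q> g \<in> borel_measurable M"
  by (rule borel_measurableI_greater) (auto simp: superlevel_maximal_op intro: sets_Union_basis)

text \<open>Marcinkiewicz interpolation between the weak type (1,1) bound and the trivial bound on
  bounded functions, on dyadic levels: the part of \<open>g\<close> below \<open>2 ^ n\<close> cannot push an average beyond \<open>2 ^ n\<close>.\<close>

lemma emeasure_superlevel_maximal_op_le:
  assumes g[measurable]: "g \<in> borel_measurable M" and s: "s > 0"
  shows "emeasure M {x \<in> space M. ennreal (2 * s) < maximal_op M \<Q> g x}
    \<le> D * (ennreal (1 / s) * (\<integral>\<^sup>+x. (if ennreal s < g x then g x else 0) \<partial>M))"
proof -
  let ?h = "\<lambda>x. if ennreal s < g x then g x else 0"
  have "emeasure M Q \<le> (\<integral>\<^sup>+x\<in>Q. ennreal (1 / s) * ?h x \<partial>M)"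
    if Q: "Q \<in> \<Q>" and avg: "ennreal (2 * s) < average M Q g" for Q
  proof -
    have [measurable]: "Q \<in> sets M" using Q by auto
    have fin: "emeasure M Q < top" using finite_basis[OF Q] .
    \<comment> \<open>One of the two copies of \<open>s\<close> pays for the part of
      \<open>g\<close> below \<open>s\<close>; it cancels because the set has finite
      measure.\<close>
    have "ennreal s * emeasure M Q + ennreal s * emeasure M Q = ennreal (2 * s) * emeasure M Q"
      using s by (simp add: ennreal_plus[symmetric] distrib_right[symmetric] del: ennreal_plus)
    also have "\<dots> \<le> (\<integral>\<^sup>+x\<in>Q. g x \<partial>M)" by (rule less_average_imp[OF avg fin])
    also have "\<dots> \<le> (\<integral>\<^sup>+x. ennreal s * indicator Q x + ?h x * indicator Q x \<partial>M)"
      by (intro nn_integral_mono) (auto simp: indicator_def)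
    also have "\<dots> = ennreal s * emeasure M Q + (\<integral>\<^sup>+x\<in>Q. ?h x \<partial>M)"
      by (subst nn_integral_add) (auto simp: nn_integral_cmult_indicator)
    finally have "ennreal s * emeasure M Q + ennreal s * emeasure M Q
      \<le> ennreal s * emeasure M Q + (\<integral>\<^sup>+x\<in>Q. ?h x \<partial>M)" .
    moreover have "ennreal s * emeasure M Q \<noteq> top"
      using fin by (simp add: ennreal_mult_eq_top_iff)
    ultimately have "ennreal s * emeasure M Q \<le> (\<integral>\<^sup>+x\<in>Q. ?h x \<partial>M)"
      unfolding ennreal_add_left_cancel_le infinity_ennreal_def by blast
    then have "ennreal (1 / s) * (ennreal s * emeasure M Q) \<le> ennreal (1 / s) * (\<integral>\<^sup>+x\<in>Q. ?h x \<partial>M)"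
      by (rule mult_left_mono) simp
    also have "ennreal (1 / s) * (ennreal s * emeasure M Q) = emeasure M Q"
      using s by (simp add: mult.assoc[symmetric] ennreal_mult[symmetric])
    finally show ?thesis
      by (subst (asm) nn_integral_cmult[symmetric]) (auto simp: mult.assoc)
  qed
  then have "emeasure M (\<Union>{Q \<in> \<Q>. ennreal (2 * s) < average M Q g})
    \<le> D * (\<integral>\<^sup>+x. ennreal (1 / s) * ?h x \<partial>M)"
    by (intro emeasure_Union_le) auto
  then show ?thesis by (simp add: superlevel_maximal_op nn_integral_cmult)
qed

lemma nn_integral_maximal_op_le:
  assumes g[measurable]: "g \<in> borel_measurable M" and p: "p > 1"
  shows "(\<integral>\<^sup>+x. ennpowr (maximal_op M \<Q> g x) p \<partial>M)
    \<le> D * ennreal (4 powr p / (1 - 2 powr (1 - p))) * (\<integral>\<^sup>+x. ennpowr (g x) p \<partial>M)"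
proof -
  let ?G = "maximal_op M \<Q> g"
  let ?h = "\<lambda>(n::int) x. if ennreal (2 powr real_of_int n) < g x then g x else 0"
  have r1: "2 powr (1 - p) < 1" using p by (simp add: powr_less_one)
  have "(\<integral>\<^sup>+x. ennpowr (?G x) p \<partial>M)
    \<le> (\<integral>\<^sup>+x. (\<integral>\<^sup>+n. (if ennreal (2 powr (real_of_int n + 1)) < ?G x then ennreal (2 powr ((real_of_int n + 2) * p)) else 0)
           \<partial>count_space (UNIV::int set)) \<partial>M)"
    using p by (intro nn_integral_mono ennpowr_le_dyadic_sum) auto
  also have "\<dots> = (\<integral>\<^sup>+n. (\<integral>\<^sup>+x. (if ennreal (2 powr (real_of_int n + 1)) < ?G x then ennreal (2 powr ((real_of_int n + 2) * p)) else 0)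
           \<partial>M) \<partial>count_space (UNIV::int set))"
    by (rule nn_integral_count_space_nn_integral) auto
  also have "\<dots> = (\<integral>\<^sup>+n. ennreal (2 powr ((real_of_int n + 2) * p)) * emeasure M {x \<in> space M. ennreal (2 * 2 powr real_of_int n) < ?G x}
           \<partial>count_space (UNIV::int set))"
  proof (intro nn_integral_cong)
    fix n :: int
    have "(\<integral>\<^sup>+x. (if ennreal (2 powr (real_of_int n + 1)) < ?G x then ennreal (2 powr ((real_of_int n + 2) * p)) else 0) \<partial>M)
      = (\<integral>\<^sup>+x. ennreal (2 powr ((real_of_int n + 2) * p)) * indicator {x \<in> space M. ennreal (2 * 2 powr real_of_int n) < ?G x} x \<partial>M)"
      by (intro nn_integral_cong) (auto simp: indicator_def powr_add mult.commute)
    then show "(\<integral>\<^sup>+x. (if ennreal (2 powr (real_of_int n + 1)) < ?G x then ennreal (2 powr ((real_of_int n + 2) * p)) else 0) \<partial>M)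
      = ennreal (2 powr ((real_of_int n + 2) * p)) * emeasure M {x \<in> space M. ennreal (2 * 2 powr real_of_int n) < ?G x}"
      by (simp add: nn_integral_cmult_indicator)
  qed
  \<comment> \<open>The weak bound is used with s = 2^n, and 2^((n+2)p) / 2^n = 4^p
    2^(n(p-1)).\<close>
  also have "\<dots> \<le> (\<integral>\<^sup>+n. D * ennreal (4 powr p) * (\<integral>\<^sup>+x. ennreal (2 powr (real_of_int n * (p - 1))) * ?h n x \<partial>M) \<partial>count_space (UNIV::int set))"
  proof (intro nn_integral_mono)
    fix n :: int
    have "ennreal (2 powr ((real_of_int n + 2) * p)) * emeasure M {x \<in> space M. ennreal (2 * 2 powr real_of_int n) < ?G x}
      \<le> ennreal (2 powr ((real_of_int n + 2) * p)) * (D * (ennreal (1 / 2 powr real_of_int n) * (\<integral>\<^sup>+x. ?h n x \<partial>M)))"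
      by (intro mult_left_mono emeasure_superlevel_maximal_op_le) auto
    also have "\<dots> = D * (ennreal (2 powr ((real_of_int n + 2) * p)) * ennreal (1 / 2 powr real_of_int n)) * (\<integral>\<^sup>+x. ?h n x \<partial>M)"
      by (simp add: ac_simps)
    also have "ennreal (2 powr ((real_of_int n + 2) * p)) * ennreal (1 / 2 powr real_of_int n) = ennreal (4 powr p) * ennreal (2 powr (real_of_int n * (p - 1)))"
    proof -
      have "(4::real) powr p = 2 powr (2 * p)" using powr_powr[of 2 2 p] by simp
      then show ?thesis
        by (simp add: ennreal_mult[symmetric] divide_powr_uminus powr_add[symmetric] algebra_simps)
    qed
    finally show "ennreal (2 powr ((real_of_int n + 2) * p)) * emeasure M {x \<in> space M. ennreal (2 * 2 powr real_of_int n) < ?G x}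
      \<le> D * ennreal (4 powr p) * (\<integral>\<^sup>+x. ennreal (2 powr (real_of_int n * (p - 1))) * ?h n x \<partial>M)"
      by (simp add: nn_integral_cmult mult.assoc)
  qed
  also have "\<dots> = D * ennreal (4 powr p) * (\<integral>\<^sup>+x. (\<integral>\<^sup>+n. ennreal (2 powr (real_of_int n * (p - 1))) * ?h n x \<partial>count_space (UNIV::int set)) \<partial>M)"
    by (subst nn_integral_count_space_nn_integral) (auto simp: nn_integral_cmult)
  \<comment> \<open>Pulling out g(x) leaves a dyadic sum with exponent p - 1, positive since p > 1;
    the two factors recombine to the power p.\<close>
  also have "\<dots> \<le> D * ennreal (4 powr p) * (\<integral>\<^sup>+x. ennreal (1 / (1 - 2 powr (1 - p))) * ennpowr (g x) p \<partial>M)"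
  proof (intro mult_left_mono nn_integral_mono)
    fix x
    have "(\<integral>\<^sup>+n. ennreal (2 powr (real_of_int n * (p - 1))) * ?h n x \<partial>count_space UNIV)
      = g x * (\<integral>\<^sup>+n. (if ennreal (2 powr real_of_int n) < g x then ennreal (2 powr (real_of_int n * (p - 1))) else 0) \<partial>count_space (UNIV::int set))"
      by (subst nn_integral_cmult[symmetric]) (auto intro!: nn_integral_cong simp: mult.commute)
    also have "\<dots> \<le> g x * (ennreal (1 / (1 - 2 powr - (p - 1))) * ennpowr (g x) (p - 1))"
      using p by (intro mult_left_mono dyadic_sum_le_ennpowr) auto
    also have "\<dots> = ennreal (1 / (1 - 2 powr (1 - p))) * ennpowr (g x) p"
      using ennpowr_add[of 1 "p - 1" "g x"] p by (simp add: ennpowr_one ac_simps)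
    finally show "(\<integral>\<^sup>+n. ennreal (2 powr (real_of_int n * (p - 1))) * ?h n x \<partial>count_space (UNIV::int set))
      \<le> ennreal (1 / (1 - 2 powr (1 - p))) * ennpowr (g x) p" .
  qed auto
  also have "\<dots> = D * ennreal (4 powr p / (1 - 2 powr (1 - p))) * (\<integral>\<^sup>+x. ennpowr (g x) p \<partial>M)"
  proof -
    have "ennreal (4 powr p) * ennreal (1 / (1 - 2 powr (1 - p))) = ennreal (4 powr p / (1 - 2 powr (1 - p)))"
      using r1 by (simp add: ennreal_mult[symmetric])
    then show ?thesis
      by (subst nn_integral_cmult) (auto simp: mult.assoc[symmetric], simp add: mult.assoc)
  qed
  finally show ?thesis .
qed

end

section \<open>Muckenhoupt weights\<close>

definition dual_weight :: "real \<Rightarrow> ('a \<Rightarrow> ennreal) \<Rightarrow> 'a \<Rightarrow> ennreal" where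
  "dual_weight p w x = ennpowr (w x) (- 1 / (p - 1))"

lemma measurable_dual_weight [measurable]:
  "w \<in> borel_measurable M \<Longrightarrow> dual_weight p w \<in> borel_measurable M"
  unfolding dual_weight_def[abs_def] by measurable

lemma dual_weight_pos_finite:
  "0 < w x \<and> w x < top \<Longrightarrow> 0 < dual_weight p w x \<and> dual_weight p w x < top"
  by (simp add: dual_weight_def ennpowr_pos ennpowr_less_top)

context doubling_basis
begin

text \<open>The \<open>A_p\<close> condition tested on functions, with denominators cleared so that
  null boxes are covered. It also makes sense for \<open>p = 1\<close>, which lets one weak type
  proof serve all exponents.\<close>

definition Muckenhoupt_bound :: "real \<Rightarrow> ennreal \<Rightarrow> ('a \<Rightarrow> ennreal) \<Rightarrow> bool" where
  "Muckenhoupt_bound p K w \<longleftrightarrow> (\<forall>Q\<in>\<Q>. \<forall>f\<in>borel_measurable M.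
     emeasure (density M w) Q * ennpowr (\<integral>\<^sup>+x\<in>Q. f x \<partial>M) p
       \<le> K * ennpowr (emeasure M Q) p * (\<integral>\<^sup>+x\<in>Q. ennpowr (f x) p \<partial>density M w))"

lemma density_null:
  assumes "w \<in> borel_measurable M" "Q \<in> \<Q>" "emeasure M Q = 0"
  shows "emeasure (density M w) Q = 0"
  using assms by (simp add: emeasure_density set_nn_integral_null)

text \<open>The test function on \<open>star Q\<close> is the indicator of Q; D^p is the bound for
  the p-th power of the ratio of the two \<open>M\<close>-measures.\<close>

lemma doubling_basis_density:
  assumes w[measurable]: "w \<in> borel_measurable M" and p: "p > 0" and bound: "Muckenhoupt_bound p K w"
    and fin: "\<And>Q. Q \<in> \<Q> \<Longrightarrow> emeasure (density M w) Q < top"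
  shows "doubling_basis (density M w) \<Q> size star (K * ennpowr D p)"
proof
  fix Q assume Q: "Q \<in> \<Q>"
  have [measurable]: "Q \<in> sets M" "star Q \<in> sets M" using Q star_basis by auto
  show "emeasure (density M w) (star Q) \<le> K * ennpowr D p * emeasure (density M w) Q"
  proof (cases "emeasure M Q = 0")
    case True
    \<comment> \<open>The test cannot be divided by a null measure, but doubling of \<open>M\<close>
      makes the star null as well.\<close>
    then have "emeasure M (star Q) = 0" using doubling[OF Q] by simp
    then show ?thesis using density_null[OF w star_basis[OF Q]] by simp
  next
    case False
    let ?m = "ennpowr (emeasure M Q) p"
    have m: "?m \<noteq> 0" "?m \<noteq> top" using False finite_basis[OF Q] p
      by (simp_all add: ennpowr_eq_top_iff zero_less_iff_neq_zero[symmetric] ennpowr_pos)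
    have eq: "indicator Q x * indicator (star Q) x = (indicator Q x :: ennreal)" for x
      using subset_star[OF Q] by (auto simp: indicator_def)
    have "emeasure (density M w) (star Q) * ennpowr (\<integral>\<^sup>+x\<in>star Q. indicator Q x \<partial>M) p
      \<le> K * ennpowr (emeasure M (star Q)) p * (\<integral>\<^sup>+x\<in>star Q. ennpowr (indicator Q x) p \<partial>density M w)"
      using bound star_basis[OF Q] unfolding Muckenhoupt_bound_def by auto
    then have "emeasure (density M w) (star Q) * ?m \<le> K * ennpowr (emeasure M (star Q)) p * emeasure (density M w) Q"
      using p by (simp add: eq ennpowr_indicator)
    also have "\<dots> \<le> K * ennpowr (D * emeasure M Q) p * emeasure (density M w) Q"
      using p doubling[OF Q] by (intro mult_right_mono mult_left_mono ennpowr_mono) auto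
    finally have "?m * emeasure (density M w) (star Q) \<le> ?m * (K * ennpowr D p * emeasure (density M w) Q)"
      using p by (simp add: ennpowr_mult ac_simps)
    then show ?thesis by (simp only: ennreal_mult_le_mult_iff[OF m])
  qed
qed (use basis_sets countable_subcover star_basis meets_subset_star fin in auto)

text \<open>\<open>K\<close> enters twice: once in the estimate of w(Q) by the integral of f^p, and
  once, with D^p, in the doubling constant of the covering argument.\<close>

lemma weighted_weak_type:
  assumes w[measurable]: "w \<in> borel_measurable M" and p: "p > 0" and bound: "Muckenhoupt_bound p K w"
    and fin: "\<And>Q. Q \<in> \<Q> \<Longrightarrow> emeasure (density M w) Q < top"
    and f[measurable]: "f \<in> borel_measurable M" and t: "t > 0"
  shows "emeasure (density M w) {x \<in> space M. ennreal t < maximal_op M \<Q> f x}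
    \<le> K * ennpowr D p * K * ennreal (t powr - p) * (\<integral>\<^sup>+x. ennpowr (f x) p \<partial>density M w)"
proof -
  interpret W: doubling_basis "density M w" \<Q> size star "K * ennpowr D p"
    by (rule doubling_basis_density) fact+
  have tp: "ennreal (t powr p) * ennreal (t powr - p) = 1"
    using t by (simp add: ennreal_mult[symmetric] powr_add[symmetric])
  have "emeasure (density M w) Q \<le> (\<integral>\<^sup>+x\<in>Q. K * ennreal (t powr - p) * ennpowr (f x) p \<partial>density M w)"
    if Q: "Q \<in> \<Q>" "ennreal t < average M Q f" for Q
  proof (cases "emeasure M Q = 0")
    case True then show ?thesis using density_null[OF w Q(1)] by simp
  next
    case False
    have [measurable]: "Q \<in> sets M" using Q by auto
    let ?m = "ennpowr (emeasure M Q) p" and ?W = "emeasure (density M w) Q"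
    have m: "?m \<noteq> 0" "?m \<noteq> top" using False finite_basis[OF Q(1)] p
      by (simp_all add: ennpowr_eq_top_iff zero_less_iff_neq_zero[symmetric] ennpowr_pos)
    have "?W * (ennreal (t powr p) * ?m) = ?W * ennpowr (ennreal t * emeasure M Q) p"
      using t p by (simp add: ennpowr_mult ennpowr_simps)
    also have "\<dots> \<le> ?W * ennpowr (\<integral>\<^sup>+x\<in>Q. f x \<partial>M) p"
      using less_average_imp[OF Q(2) finite_basis[OF Q(1)]] p by (intro mult_left_mono ennpowr_mono) auto
    also have "\<dots> \<le> K * ?m * (\<integral>\<^sup>+x\<in>Q. ennpowr (f x) p \<partial>density M w)"
      using bound Q(1) unfolding Muckenhoupt_bound_def by auto
    finally have "?m * (?W * ennreal (t powr p)) \<le> ?m * (K * (\<integral>\<^sup>+x\<in>Q. ennpowr (f x) p \<partial>density M w))"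
      by (simp add: ac_simps)
    then have "?W * ennreal (t powr p) \<le> K * (\<integral>\<^sup>+x\<in>Q. ennpowr (f x) p \<partial>density M w)"
      by (simp only: ennreal_mult_le_mult_iff[OF m])
    then have "?W * ennreal (t powr p) * ennreal (t powr - p)
        \<le> K * (\<integral>\<^sup>+x\<in>Q. ennpowr (f x) p \<partial>density M w) * ennreal (t powr - p)"
      by (rule mult_right_mono) simp
    also have "\<dots> = (\<integral>\<^sup>+x\<in>Q. K * ennreal (t powr - p) * ennpowr (f x) p \<partial>density M w)"
      by (subst nn_integral_cmult[symmetric] nn_integral_multc[symmetric]; simp add: ac_simps)+
    finally show ?thesis using tp by (simp add: mult.assoc)
  qed
  then have "emeasure (density M w) (\<Union>{Q \<in> \<Q>. ennreal t < average M Q f})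
    \<le> K * ennpowr D p * (\<integral>\<^sup>+x. K * ennreal (t powr - p) * ennpowr (f x) p \<partial>density M w)"
    by (intro W.emeasure_Union_le) auto
  then show ?thesis by (simp add: superlevel_maximal_op nn_integral_cmult mult.assoc)
qed

end

text \<open>With q = p/(p-1), the factors are the q-th power of Lerner's constant, the L_q maximal
  constant of w d\<mu>, and the L_p maximal constant of \<sigma> d\<mu>. The latter two contain the
  doubling constants K D^p and K^(1/(p-1)) D^q.\<close>

definition strong_const :: "real \<Rightarrow> ennreal \<Rightarrow> ennreal \<Rightarrow> ennreal" where
  "strong_const p K D = ennpowr K (p / (p - 1)) *
     (K * ennpowr D p * ennreal (4 powr (p / (p - 1)) / (1 - 2 powr (1 - p / (p - 1))))) *
     (ennpowr K (1 / (p - 1)) * ennpowr D (p / (p - 1)) * ennreal (4 powr p / (1 - 2 powr (1 - p))))"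

lemma strong_const_less_top:
  assumes "p > 1" "K < top" "D < top" shows "strong_const p K D < top"
  using assms unfolding strong_const_def
  by (intro ennreal_mult_less_top[THEN iffD2] conjI disjI2)
     (auto simp: ennreal_mult_less_top ennpowr_less_top)

text \<open>Stated through the measures w(Q) and \<sigma>(Q) instead of averages, the condition
  stays meaningful on null boxes and is visibly symmetric in w and \<sigma> up to a power.\<close>

locale Muckenhoupt_weight = doubling_basis +
  fixes p :: real and w :: "'a \<Rightarrow> ennreal" and K :: ennreal
  assumes p: "p > 1"
    and w [measurable]: "w \<in> borel_measurable M"
    and w_pos_finite: "AE x in M. 0 < w x \<and> w x < top"
    and w_finite: "Q \<in> \<Q> \<Longrightarrow> emeasure (density M w) Q < top"
    and dual_finite: "Q \<in> \<Q> \<Longrightarrow> emeasure (density M (dual_weight p w)) Q < top"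
    and A_p: "Q \<in> \<Q> \<Longrightarrow> emeasure (density M w) Q * ennpowr (emeasure (density M (dual_weight p w)) Q) (p - 1)
      \<le> K * ennpowr (emeasure M Q) p"
begin

abbreviation "\<sigma> \<equiv> dual_weight p w"

lemma dual_pos_finite: "AE x in M. 0 < \<sigma> x \<and> \<sigma> x < top"
  using w_pos_finite by eventually_elim (rule dual_weight_pos_finite)

text \<open>The second identity comes from \<sigma> = \<sigma>^p w. Dividing by \<sigma> thus
  transfers both the plain integral of f and its weighted p-th power integral to the measure
  \<sigma> d\<mu>.\<close>

lemma div_dual_identities:
  assumes "0 < w x \<and> w x < top"
  shows "f / \<sigma> x * \<sigma> x = f" "ennpowr (f / \<sigma> x) p * \<sigma> x = ennpowr f p * w x"
proof -
  have s: "0 < \<sigma> x" "\<sigma> x < top" using dual_weight_pos_finite[of w x p] assms by auto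
  then show "f / \<sigma> x * \<sigma> x = f" by (simp add: mult.commute[of _ "\<sigma> x"] ennreal_mult_divide_cancel)
  obtain v where v: "w x = ennreal v" "v > 0" using assms by (cases "w x" rule: ennreal_cases_pos) auto
  have \<sigma>: "\<sigma> x = ennreal (v powr (- 1 / (p - 1)))" using v by (simp add: dual_weight_def ennpowr_simps)
  have e: "- 1 / (p - 1) = 1 + - 1 / (p - 1) * p" using p by (simp add: field_simps)
  have "v powr (- 1 / (p - 1)) = v powr (1 + - 1 / (p - 1) * p)" by (subst e) simp
  also have "\<dots> = v * (v powr (- 1 / (p - 1))) powr p" 
    using v powr_add[of v 1 "- 1 / (p - 1) * p"] powr_powr[of v "- 1 / (p - 1)" p] by simp
  finally have "\<sigma> x = ennpowr (\<sigma> x) p * w x"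
    unfolding \<sigma> using v p by (simp add: v(1) ennpowr_simps ennreal_mult[symmetric] mult.commute)
  then have "ennpowr (f / \<sigma> x) p * \<sigma> x = ennpowr (f / \<sigma> x) p * (ennpowr (\<sigma> x) p * w x)" by simp
  also have "\<dots> = ennpowr (f / \<sigma> x * \<sigma> x) p * w x" using p by (simp add: ennpowr_mult mult.assoc)
  finally show "ennpowr (f / \<sigma> x) p * \<sigma> x = ennpowr f p * w x"
    using \<open>f / \<sigma> x * \<sigma> x = f\<close> by simp
qed

text \<open>Hoelder's inequality in the form of Jensen for f/\<sigma> against \<sigma> d\<mu>
  restricted to Q; the mass \<sigma>(Q)^(p-1) it produces is what \<open>A_p\<close>
  controls.\<close>

lemma Muckenhoupt_bound: "Muckenhoupt_bound p K w"
  unfolding Muckenhoupt_bound_def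
proof (intro ballI)
  fix Q and f :: "'a \<Rightarrow> ennreal" assume Q: "Q \<in> \<Q>" and f[measurable]: "f \<in> borel_measurable M"
  have [measurable]: "Q \<in> sets M" using Q by auto
  let ?N = "density M (\<lambda>x. \<sigma> x * indicator Q x)" and ?S = "emeasure (density M \<sigma>) Q"
    and ?W = "emeasure (density M w) Q"
  have S: "emeasure ?N (space ?N) = ?S"
    by (simp add: emeasure_density mult.assoc) (intro nn_integral_cong; simp add: indicator_def)
  have "AE x in M. \<sigma> x * indicator Q x * (f x / \<sigma> x) = f x * indicator Q x"
    using w_pos_finite
  proof eventually_elim
    case (elim x)
    have "\<sigma> x * indicator Q x * (f x / \<sigma> x) = (f x / \<sigma> x * \<sigma> x) * indicator Q x" by (simp only: ac_simps)
    then show ?case by (simp only: div_dual_identities[OF elim])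
  qed
  then have "(\<integral>\<^sup>+x. f x / \<sigma> x \<partial>?N) = (\<integral>\<^sup>+x\<in>Q. f x \<partial>M)"
    by (subst nn_integral_density) (auto intro!: nn_integral_cong_AE)
  moreover have "AE x in M. \<sigma> x * indicator Q x * ennpowr (f x / \<sigma> x) p = w x * (ennpowr (f x) p * indicator Q x)"
    using w_pos_finite
  proof eventually_elim
    case (elim x)
    have "\<sigma> x * indicator Q x * ennpowr (f x / \<sigma> x) p = (ennpowr (f x / \<sigma> x) p * \<sigma> x) * indicator Q x"
      by (simp only: ac_simps)
    also have "\<dots> = (ennpowr (f x) p * w x) * indicator Q x" by (simp only: div_dual_identities[OF elim])
    finally show ?case by (simp only: ac_simps)
  qed
  then have "(\<integral>\<^sup>+x. ennpowr (f x / \<sigma> x) p \<partial>?N) = (\<integral>\<^sup>+x\<in>Q. ennpowr (f x) p \<partial>density M w)"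
    by (subst (1 2) nn_integral_density) (auto intro!: nn_integral_cong_AE)
  moreover have "ennpowr (\<integral>\<^sup>+x. f x / \<sigma> x \<partial>?N) p
    \<le> (\<integral>\<^sup>+x. ennpowr (f x / \<sigma> x) p \<partial>?N) * ennpowr (emeasure ?N (space ?N)) (p - 1)"
    using dual_finite[OF Q] p by (intro Jensen_ennpowr) (simp_all only: S, measurable)
  ultimately have "?W * ennpowr (\<integral>\<^sup>+x\<in>Q. f x \<partial>M) p
      \<le> ?W * ((\<integral>\<^sup>+x\<in>Q. ennpowr (f x) p \<partial>density M w) * ennpowr ?S (p - 1))"
    using S by (intro mult_left_mono) auto
  also have "\<dots> = (?W * ennpowr ?S (p - 1)) * (\<integral>\<^sup>+x\<in>Q. ennpowr (f x) p \<partial>density M w)"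
    by (simp add: ac_simps)
  also have "\<dots> \<le> K * ennpowr (emeasure M Q) p * (\<integral>\<^sup>+x\<in>Q. ennpowr (f x) p \<partial>density M w)"
    using A_p[OF Q] by (rule mult_right_mono) simp
  finally show "?W * ennpowr (\<integral>\<^sup>+x\<in>Q. f x \<partial>M) p
    \<le> K * ennpowr (emeasure M Q) p * (\<integral>\<^sup>+x\<in>Q. ennpowr (f x) p \<partial>density M w)" .
qed

section \<open>Duality between the weights, and doubling of both measures\<close>

lemma dual_dual: "AE x in M. dual_weight (p / (p - 1)) \<sigma> x = w x"
  using w_pos_finite
proof eventually_elim
  case (elim x)
  have "- 1 / (p / (p - 1) - 1) = - (p - 1)" using p by (simp add: field_simps)
  then have "dual_weight (p / (p - 1)) \<sigma> x = ennpowr (ennpowr (w x) (- 1 / (p - 1))) (- (p - 1))"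
    by (simp only: dual_weight_def)
  also have "\<dots> = ennpowr (w x) (- 1 / (p - 1) * - (p - 1))" using p by (intro ennpowr_ennpowr) auto
  also have "- 1 / (p - 1) * - (p - 1) = 1" using p by (simp add: field_simps)
  finally show ?case by (simp only: ennpowr_one)
qed

lemma emeasure_dual_dual: "A \<in> sets M \<Longrightarrow> emeasure (density M (dual_weight (p / (p - 1)) \<sigma>)) A = emeasure (density M w) A"
  using dual_dual by (subst (1 2) emeasure_density) (auto intro!: nn_integral_cong_AE elim!: eventually_mono)

text \<open>Raising the \<open>A_p\<close> inequality to the power 1/(p-1) exchanges the roles of w
  and \<sigma>, so every result for w holds for \<sigma> with the conjugate exponent.\<close>

lemma dual_weight_class:
  "Muckenhoupt_weight M \<Q> size star D (p / (p - 1)) \<sigma> (ennpowr K (1 / (p - 1)))"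
proof
  show "p / (p - 1) > 1" using p by simp
  show "AE x in M. 0 < \<sigma> x \<and> \<sigma> x < top" by (rule dual_pos_finite)
  fix Q assume Q: "Q \<in> \<Q>"
  show "emeasure (density M \<sigma>) Q < top" by (rule dual_finite[OF Q])
  show "emeasure (density M (dual_weight (p / (p - 1)) \<sigma>)) Q < top"
    using w_finite[OF Q] Q by (simp add: emeasure_dual_dual)
  have "ennpowr (emeasure (density M w) Q * ennpowr (emeasure (density M \<sigma>) Q) (p - 1)) (1 / (p - 1))
    \<le> ennpowr (K * ennpowr (emeasure M Q) p) (1 / (p - 1))"
    using A_p[OF Q] p by (intro ennpowr_mono) auto
  moreover have "p / (p - 1) - 1 = 1 / (p - 1)" using p by (simp add: field_simps)
  ultimately show "emeasure (density M \<sigma>) Q * ennpowr (emeasure (density M (dual_weight (p / (p - 1)) \<sigma>)) Q) (p / (p - 1) - 1)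
    \<le> ennpowr K (1 / (p - 1)) * ennpowr (emeasure M Q) (p / (p - 1))"
    using p Q by (simp add: ennpowr_mult ennpowr_ennpowr ennpowr_one emeasure_dual_dual mult.commute)
qed simp

lemma doubling_basis_w: "doubling_basis (density M w) \<Q> size star (K * ennpowr D p)"
  using p by (intro doubling_basis_density Muckenhoupt_bound w_finite) auto

lemma doubling_basis_dual:
  "doubling_basis (density M \<sigma>) \<Q> size star (ennpowr K (1 / (p - 1)) * ennpowr D (p / (p - 1)))"
  by (rule Muckenhoupt_weight.doubling_basis_w[OF dual_weight_class])

lemma nn_integral_div_dual:
  assumes [measurable]: "f \<in> borel_measurable M" "Q \<in> sets M"
  shows "(\<integral>\<^sup>+x\<in>Q. f x / \<sigma> x \<partial>density M \<sigma>) = (\<integral>\<^sup>+x\<in>Q. f x \<partial>M)"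
proof -
  have "AE x in M. \<sigma> x * (f x / \<sigma> x * indicator Q x) = f x * indicator Q x"
    using w_pos_finite
  proof eventually_elim
    case (elim x)
    have "\<sigma> x * (f x / \<sigma> x * indicator Q x) = (f x / \<sigma> x * \<sigma> x) * indicator Q x" by (simp only: ac_simps)
    then show ?case by (simp only: div_dual_identities[OF elim])
  qed
  then show ?thesis by (subst nn_integral_density) (auto intro!: nn_integral_cong_AE)
qed

text \<open>Lerner's pointwise bound: it reduces the weighted maximal theorem to the unweighted one for the
  two doubling measures \<open>\<sigma> d\<mu>\<close> and \<open>w d\<mu>\<close>, with no need for the openness of the class \<open>A_p\<close>.\<close>

lemma ennpowr_average_le:
  assumes f[measurable]: "f \<in> borel_measurable M" and Q: "Q \<in> \<Q>"
  defines "G \<equiv> maximal_op (density M \<sigma>) \<Q> (\<lambda>y. f y / \<sigma> y)"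
  shows "ennpowr (average M Q f) (p - 1) \<le> K * average (density M w) Q (\<lambda>y. ennpowr (G y) (p - 1) / w y)"
proof (cases "emeasure M Q = 0")
  case True
  then have "average M Q f = 0" using Q by (simp add: average_def set_nn_integral_null)
  then show ?thesis using p by (simp add: ennpowr_0)
next
  case False
  interpret S: doubling_basis "density M \<sigma>" \<Q> size star "ennpowr K (1 / (p - 1)) * ennpowr D (p / (p - 1))"
    by (rule doubling_basis_dual)
  have [measurable]: "Q \<in> sets M" using Q by auto
  have [measurable]: "G \<in> borel_measurable M"
    using S.measurable_maximal_op unfolding G_def by (simp add: measurable_density_eq1)
  define m where "m = emeasure M Q"
  define S where "S = emeasure (density M \<sigma>) Q"
  define W where "W = emeasure (density M w) Q"
  define A where "A = (\<integral>\<^sup>+x\<in>Q. f x \<partial>M)"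
  define s n a where "s = ennpowr S (p - 1)" and "n = ennpowr m (p - 1)" and "a = ennpowr A (p - 1)"
  have m: "0 < m" "m < top" using False finite_basis[OF Q] by (auto simp: m_def zero_less_iff_neq_zero)
  have "0 < W" unfolding W_def using w_pos_finite False
    by (subst emeasure_density) (auto intro!: set_nn_integral_pos elim!: eventually_mono)
  then have W: "W \<noteq> 0" "W \<noteq> top" using w_finite[OF Q] by (auto simp: W_def)
  have "0 < S" unfolding S_def using dual_pos_finite False
    by (subst emeasure_density) (auto intro!: set_nn_integral_pos elim!: eventually_mono)
  then have S: "0 < S" "S < top" using dual_finite[OF Q] by (auto simp: S_def)
  have s: "s \<noteq> 0" "s \<noteq> top" and n: "n \<noteq> 0" "n \<noteq> top"
    using S m p ennpowr_pos[of S "p - 1"] ennpowr_less_top[of S "p - 1"]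
      ennpowr_pos[of m "p - 1"] ennpowr_less_top[of m "p - 1"] by (auto simp: s_def n_def)
  have "ennpowr m p = m * n" using ennpowr_add[of 1 "p - 1" m] p by (simp add: n_def ennpowr_one)
  then have Ws: "W * s \<le> K * (m * n)" using A_p[OF Q] by (simp add: W_def S_def s_def m_def)
  have A_S: "average (density M \<sigma>) Q (\<lambda>y. f y / \<sigma> y) = A / S"
    by (simp add: average_def nn_integral_div_dual A_def S_def)
  \<comment> \<open>On all of Q the function \<open>G\<close> is at least the \<sigma>-average
    \<open>A / S\<close>, hence its power p - 1 is at least \<open>a / s\<close>.\<close>
  have "a / s * m = (\<integral>\<^sup>+x\<in>Q. a / s \<partial>M)" by (simp add: m_def nn_integral_cmult_indicator)
  also have "\<dots> \<le> (\<integral>\<^sup>+x\<in>Q. ennpowr (G x) (p - 1) \<partial>M)"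
  proof (intro nn_integral_mono)
    fix x
    have "A / S \<le> G x" if "x \<in> Q"
      unfolding A_S[symmetric] G_def using Q that by (rule average_le_maximal_op)
    then have "a / s \<le> ennpowr (G x) (p - 1)" if "x \<in> Q"
      using that p S by (simp add: a_def s_def ennpowr_divide[symmetric] ennpowr_mono)
    then show "a / s * indicator Q x \<le> ennpowr (G x) (p - 1) * indicator Q x" by (auto simp: indicator_def)
  qed
  \<comment> \<open>Passing from \<mu> to w d\<mu> costs the factor 1/w; this is its origin in
    Lerner's estimate.\<close>
  also have "\<dots> = (\<integral>\<^sup>+x\<in>Q. ennpowr (G x) (p - 1) / w x \<partial>density M w)" (is "_ = ?H")
  proof (subst nn_integral_density)
    have "AE x in M. ennpowr (G x) (p - 1) * indicator Q x = w x * (ennpowr (G x) (p - 1) / w x * indicator Q x)"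
      using w_pos_finite
    proof eventually_elim
      case (elim x)
      then have "w x * (ennpowr (G x) (p - 1) / w x) = ennpowr (G x) (p - 1)"
        by (intro ennreal_mult_divide_cancel) auto
      then show ?case by (simp only: mult.assoc[symmetric])
    qed
    then show "(\<integral>\<^sup>+x\<in>Q. ennpowr (G x) (p - 1) \<partial>M)
      = (\<integral>\<^sup>+x. w x * (ennpowr (G x) (p - 1) / w x * indicator Q x) \<partial>M)" by (rule nn_integral_cong_AE)
  qed auto
  finally have H: "a / s * m \<le> ?H" .
  \<comment> \<open>Cancellation needs a finite nonzero factor. This one clears the quotients by
    \<open>n\<close>, \<open>s\<close> and \<open>W\<close> together, turning the identity behind
    the estimate into a chain of products.\<close>
  let ?c = "n * (W * s)"
  have c: "?c \<noteq> 0" "?c \<noteq> top" using s n W by (auto simp: ennreal_mult_eq_top_iff)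
  have "?c * (a / n) = (W * s) * (n * (a / n))" by (simp only: ac_simps)
  also have "\<dots> = (W * s) * a" by (simp only: ennreal_mult_divide_cancel[OF n])
  also have "\<dots> \<le> K * (m * n) * a" using Ws by (rule mult_right_mono) simp
  also have "\<dots> = K * (n * (s * (a / s) * m))" by (simp only: ennreal_mult_divide_cancel[OF s]) (simp only: ac_simps)
  also have "\<dots> = K * (n * (s * (a / s * m)))" by (simp only: ac_simps)
  also have "\<dots> \<le> K * (n * (s * ?H))" using H by (intro mult_left_mono) auto
  also have "\<dots> = K * (n * (s * (W * (?H / W))))" by (simp only: ennreal_mult_divide_cancel[OF W])
  also have "\<dots> = ?c * (K * (?H / W))" by (simp only: ac_simps)
  finally have "a / n \<le> K * (?H / W)" by (simp only: ennreal_mult_le_mult_iff[OF c])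
  moreover have "ennpowr (average M Q f) (p - 1) = a / n"
    using p m by (simp add: average_def a_def n_def A_def m_def ennpowr_divide)
  ultimately show ?thesis by (simp add: average_def W_def)
qed

text \<open>Moving the power to the other side by \<open>ennpowr_le_iff\<close> leaves a plain upper
  bound for a supremum.\<close>

lemma ennpowr_maximal_op_le:
  assumes f[measurable]: "f \<in> borel_measurable M"
  defines "G \<equiv> maximal_op (density M \<sigma>) \<Q> (\<lambda>y. f y / \<sigma> y)"
  shows "ennpowr (maximal_op M \<Q> f x) (p - 1) \<le> K * maximal_op (density M w) \<Q> (\<lambda>y. ennpowr (G y) (p - 1) / w y) x"
    (is "_ \<le> K * ?MH")
proof -
  have "average M Q f \<le> ennpowr (K * ?MH) (1 / (p - 1))" if "Q \<in> \<Q>" "x \<in> Q" for Q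
  proof -
    have "ennpowr (average M Q f) (p - 1) \<le> K * average (density M w) Q (\<lambda>y. ennpowr (G y) (p - 1) / w y)"
      unfolding G_def by (rule ennpowr_average_le[OF f that(1)])
    also have "\<dots> \<le> K * ?MH" using that by (intro mult_left_mono average_le_maximal_op) auto
    finally show ?thesis using p by (simp add: ennpowr_le_iff)
  qed
  then have "maximal_op M \<Q> f x \<le> ennpowr (K * ?MH) (1 / (p - 1))"
    unfolding maximal_op_def[of M] by (intro SUP_least) auto
  then show ?thesis using p by (simp add: ennpowr_le_iff)
qed

lemma weighted_strong_type:
  assumes f[measurable]: "f \<in> borel_measurable M"
  shows "(\<integral>\<^sup>+x. ennpowr (maximal_op M \<Q> f x) p \<partial>density M w)
    \<le> strong_const p K D * (\<integral>\<^sup>+x. ennpowr (f x) p \<partial>density M w)"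
proof -
  interpret S: doubling_basis "density M \<sigma>" \<Q> size star "ennpowr K (1 / (p - 1)) * ennpowr D (p / (p - 1))"
    by (rule doubling_basis_dual)
  interpret W: doubling_basis "density M w" \<Q> size star "K * ennpowr D p"
    by (rule doubling_basis_w)
  let ?q = "p / (p - 1)"
  define F where "F = (\<lambda>y. f y / \<sigma> y)"
  define G where "G = maximal_op (density M \<sigma>) \<Q> F"
  define H where "H = (\<lambda>y. ennpowr (G y) (p - 1) / w y)"
  have F[measurable]: "F \<in> borel_measurable M" unfolding F_def by measurable
  have G[measurable]: "G \<in> borel_measurable M"
    using S.measurable_maximal_op unfolding G_def by (simp add: measurable_density_eq1)
  have H[measurable]: "H \<in> borel_measurable M" unfolding H_def by measurable
  have MH[measurable]: "maximal_op (density M w) \<Q> H \<in> borel_measurable M"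
    using W.measurable_maximal_op by (simp add: measurable_density_eq1)
  have q: "?q > 1" "(p - 1) * ?q = p" using p by (simp_all add: field_simps)
  have "ennpowr (maximal_op M \<Q> f x) p \<le> ennpowr K ?q * ennpowr (maximal_op (density M w) \<Q> H x) ?q" for x
  proof -
    have "ennpowr (maximal_op M \<Q> f x) p = ennpowr (ennpowr (maximal_op M \<Q> f x) (p - 1)) ?q"
      using p q by (subst ennpowr_ennpowr) auto
    also have "\<dots> \<le> ennpowr (K * maximal_op (density M w) \<Q> H x) ?q"
      using ennpowr_maximal_op_le[OF f, of x] q(1)
      unfolding H_def G_def F_def by (intro ennpowr_mono) auto
    finally show ?thesis using q(1) by (simp add: ennpowr_mult)
  qed
  then have "(\<integral>\<^sup>+x. ennpowr (maximal_op M \<Q> f x) p \<partial>density M w)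
    \<le> (\<integral>\<^sup>+x. ennpowr K ?q * ennpowr (maximal_op (density M w) \<Q> H x) ?q \<partial>density M w)"
    by (intro nn_integral_mono)
  also have "\<dots> = ennpowr K ?q * (\<integral>\<^sup>+x. ennpowr (maximal_op (density M w) \<Q> H x) ?q \<partial>density M w)"
    by (rule nn_integral_cmult) measurable
  also have "\<dots> \<le> ennpowr K ?q * (K * ennpowr D p * ennreal (4 powr ?q / (1 - 2 powr (1 - ?q)))
      * (\<integral>\<^sup>+x. ennpowr (H x) ?q \<partial>density M w))"
    using q(1) by (intro mult_left_mono W.nn_integral_maximal_op_le) auto
  \<comment> \<open>Since (p-1)q = p and 1 - q = -1/(p-1), one has H^q w = G^p w^(1-q) = G^p
    \<sigma>.\<close>
  also have "(\<integral>\<^sup>+x. ennpowr (H x) ?q \<partial>density M w) = (\<integral>\<^sup>+x. ennpowr (G x) p \<partial>density M \<sigma>)"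
  proof -
    have "AE x in M. w x * ennpowr (H x) ?q = \<sigma> x * ennpowr (G x) p"
      using w_pos_finite
    proof eventually_elim
      case (elim x)
      then obtain v where v: "w x = ennreal v" "v > 0" by (cases "w x" rule: ennreal_cases_pos) auto
      have "ennpowr (H x) ?q = ennpowr (ennpowr (G x) (p - 1)) ?q / ennpowr (w x) ?q"
        unfolding H_def using elim q(1) by (intro ennpowr_divide) auto
      also have "ennpowr (ennpowr (G x) (p - 1)) ?q = ennpowr (G x) p"
        using p q by (subst ennpowr_ennpowr) auto
      finally have "w x * ennpowr (H x) ?q = (w x / ennpowr (w x) ?q) * ennpowr (G x) p"
        by (simp add: ennreal_times_divide ennreal_divide_times mult.commute)
      moreover have "w x / ennpowr (w x) ?q = \<sigma> x"
      proof -
        have "- 1 / (p - 1) = 1 - ?q" using p by (simp add: field_simps)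
        then show ?thesis using v
          by (simp add: dual_weight_def ennpowr_simps divide_ennreal powr_diff)
      qed
      ultimately show ?case by simp
    qed
    then show ?thesis by (subst (1 2) nn_integral_density) (auto intro!: nn_integral_cong_AE)
  qed
  also have "(\<integral>\<^sup>+x. ennpowr (G x) p \<partial>density M \<sigma>)
    \<le> ennpowr K (1 / (p - 1)) * ennpowr D ?q * ennreal (4 powr p / (1 - 2 powr (1 - p)))
      * (\<integral>\<^sup>+x. ennpowr (F x) p \<partial>density M \<sigma>)"
    unfolding G_def using p by (intro S.nn_integral_maximal_op_le) auto
  also have "(\<integral>\<^sup>+x. ennpowr (F x) p \<partial>density M \<sigma>) = (\<integral>\<^sup>+x. ennpowr (f x) p \<partial>density M w)"
  proof -
    have "AE x in M. \<sigma> x * ennpowr (F x) p = w x * ennpowr (f x) p"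
      using w_pos_finite
    proof eventually_elim
      case (elim x)
      then show ?case using div_dual_identities(2)[OF elim, of "f x"] by (simp add: F_def mult.commute)
    qed
    then show ?thesis by (subst (1 2) nn_integral_density) (auto intro!: nn_integral_cong_AE)
  qed
  finally show ?thesis by (simp add: strong_const_def mult.assoc mult_left_mono)
qed

end

section \<open>Attained weight constants, and conditions on averages as conditions on
  measures\<close>

context doubling_basis
begin

lemma average_pos:
  assumes "g \<in> borel_measurable M" "AE x in M. 0 < g x" "Q \<in> \<Q>" "emeasure M Q \<noteq> 0"
  shows "0 < average M Q g"
  using set_nn_integral_pos[of g M Q] assms finite_basis[of Q] by (simp add: average_def ennreal_zero_less_divide)

text \<open>A box of positive measure supplies the index that keeps admissible constants away from
  0. For \<open>p = 1\<close> the condition is pointwise, so the indices are pairs of a box and a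
  point in it.\<close>

lemma A_bound_A_const:
  assumes p: "p \<ge> 1" and w: "A_weight p M \<Q> w" and Q0: "Q0 \<in> \<Q>" "emeasure M Q0 \<noteq> 0"
  shows "A_bound p M \<Q> w (A_const p M \<Q> w)"
proof -
  have [measurable]: "w \<in> borel_measurable M" and pf: "AE x in M. 0 < w x \<and> w x < top"
    and ex: "\<exists>N. A_bound p M \<Q> w N"
    using w by (auto simp: A_weight_def is_weight_def)
  have avg_w: "0 < average M Q0 w" using pf Q0 by (intro average_pos) auto
  show ?thesis
  proof (cases "p = 1")
    case True
    define J where "J = Sigma \<Q> (\<lambda>Q. Q)"
    have eq: "A_bound p M \<Q> w N \<longleftrightarrow> (\<forall>i\<in>J. average M (fst i) w \<le> ennreal N * w (snd i))" for N
      using True by (auto simp: A_bound_def J_def)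
    \<comment> \<open>\<open>w\<close> is finite almost everywhere, so a non-null box contains a
      point where it is finite.\<close>
    obtain x0 where x0: "x0 \<in> Q0" "w x0 < top"
    proof (rule ccontr)
      assume "\<not> thesis"
      then have *: "x \<notin> Q0 \<or> \<not> w x < top" for x using that by auto
      from pf have "AE x in M. x \<notin> Q0" by eventually_elim (use * in blast)
      then have "emeasure M {x \<in> space M. x \<in> Q0} = 0" by (rule emeasure_eq_0_AE)
      moreover have "{x \<in> space M. x \<in> Q0} = Q0" using sets.sets_into_space[OF sets_basis[OF Q0(1)]] by blast
      ultimately show False using Q0(2) by simp
    qed
    show ?thesis unfolding A_const_def eq
      using ex avg_w Q0 x0 unfolding eq
      by (intro Least_constant[where base = "(Q0, x0)"]) (auto simp: J_def)
  next
    case False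
    let ?X = "\<lambda>Q. average M Q w * ennpowr (average M Q (\<lambda>x. ennpowr (w x) (- 1 / (p - 1)))) (p - 1)"
    have eq: "A_bound p M \<Q> w N \<longleftrightarrow> (\<forall>Q\<in>\<Q>. ?X Q \<le> ennreal N * 1)" for N
      using False by (simp add: A_bound_def)
    have "AE x in M. 0 < dual_weight p w x"
      using pf by eventually_elim (rule conjunct1[OF dual_weight_pos_finite])
    then have "0 < average M Q0 (dual_weight p w)" using Q0 by (intro average_pos) auto
    then have "0 < ennpowr (average M Q0 (dual_weight p w)) (p - 1)"
      using p False by (intro ennpowr_pos) auto
    then have "0 < ?X Q0"
      using avg_w unfolding dual_weight_def[abs_def] by (simp add: ennreal_zero_less_mult_iff)
    then show ?thesis unfolding A_const_def eq
      using ex Q0 unfolding eq by (intro Least_constant[where base = Q0]) auto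
  qed
qed

lemma emeasure_density_less_top:
  assumes g[measurable]: "g \<in> borel_measurable M" and Q: "Q \<in> \<Q>"
    and avg: "emeasure M Q \<noteq> 0 \<Longrightarrow> average M Q g < top"
  shows "emeasure (density M g) Q < top"
proof (cases "emeasure M Q = 0")
  case True then show ?thesis using density_null[OF g Q] by simp
next
  case False
  then show ?thesis using avg finite_basis[OF Q] Q
    by (auto simp: average_def emeasure_density less_top[symmetric] ennreal_divide_eq_top_iff)
qed

lemma average_eq_density:
  assumes "g \<in> borel_measurable M" "Q \<in> \<Q>"
  shows "average M Q g = emeasure (density M g) Q / emeasure M Q"
  using assms by (simp add: average_def emeasure_density)

text \<open>The pointwise bound of w(Q) by c w(x) \<mu>(Q) is multiplied by f(x) and integrated over
  Q.\<close>

lemma Muckenhoupt_bound_1: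
  assumes w: "is_weight M \<Q> w" and A: "A_bound 1 M \<Q> w c"
  shows "Muckenhoupt_bound 1 (ennreal c) w"
  unfolding Muckenhoupt_bound_def
proof (intro ballI)
  fix Q and f :: "'a \<Rightarrow> ennreal" assume Q: "Q \<in> \<Q>" and f[measurable]: "f \<in> borel_measurable M"
  have [measurable]: "w \<in> borel_measurable M" "Q \<in> sets M" using w Q by (auto simp: is_weight_def)
  let ?W = "emeasure (density M w) Q" and ?m = "emeasure M Q"
  have "?W \<le> ennreal c * w x * ?m" if "x \<in> Q" for x
  proof (cases "?m = 0")
    case True then show ?thesis using density_null[of w Q] Q by simp
  next
    case False
    have "?W / ?m \<le> ennreal c * w x"
      using A Q that average_eq_density[of w Q] by (auto simp: A_bound_def)
    then have "?m * (?W / ?m) \<le> ?m * (ennreal c * w x)" by (rule mult_left_mono) simp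
    moreover have "?m * (?W / ?m) = ?W" using False finite_basis[OF Q] by (intro ennreal_mult_divide_cancel) auto
    ultimately show ?thesis by (simp add: ac_simps)
  qed
  then have "?W * (f x * indicator Q x) \<le> ennreal c * w x * ?m * (f x * indicator Q x)" for x
    by (cases "x \<in> Q") (auto intro: mult_right_mono)
  then have "(\<integral>\<^sup>+x. ?W * (f x * indicator Q x) \<partial>M) \<le> (\<integral>\<^sup>+x. ennreal c * ?m * (w x * (f x * indicator Q x)) \<partial>M)"
    by (intro nn_integral_mono) (simp add: ac_simps)
  then show "?W * ennpowr (\<integral>\<^sup>+x\<in>Q. f x \<partial>M) 1 \<le> ennreal c * ennpowr ?m 1 * (\<integral>\<^sup>+x\<in>Q. ennpowr (f x) 1 \<partial>density M w)"
    by (simp add: ennpowr_one nn_integral_cmult nn_integral_density)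
qed

text \<open>Finiteness of \<sigma>(Q) is extracted from the bound itself: on a non-null box the
  average of w is positive, so an infinite average of \<sigma> would make the product
  infinite.\<close>

lemma Muckenhoupt_weight_A_bound:
  assumes p: "p > 1" and w: "is_weight M \<Q> w" and A: "A_bound p M \<Q> w c"
  shows "Muckenhoupt_weight M \<Q> size star D p w (ennreal c)"
proof
  have [measurable]: "w \<in> borel_measurable M" and pf: "AE x in M. 0 < w x \<and> w x < top"
    and avg: "\<And>Q. Q \<in> \<Q> \<Longrightarrow> average M Q w < top"
    using w by (auto simp: is_weight_def)
  show "p > 1" "w \<in> borel_measurable M" "AE x in M. 0 < w x \<and> w x < top" by fact+
  fix Q assume Q: "Q \<in> \<Q>"
  show W: "emeasure (density M w) Q < top"
    using avg[OF Q] Q by (intro emeasure_density_less_top) auto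
  have bound: "average M Q w * ennpowr (average M Q (dual_weight p w)) (p - 1) \<le> ennreal c"
    using A Q p by (auto simp: A_bound_def dual_weight_def[abs_def])
  show S: "emeasure (density M (dual_weight p w)) Q < top"
  proof (rule emeasure_density_less_top)
    assume "emeasure M Q \<noteq> 0"
    then have "average M Q w \<noteq> 0" using average_pos[of w Q] pf Q by auto
    then have "ennpowr (average M Q (dual_weight p w)) (p - 1) \<noteq> top"
      using bound by (auto simp: ennreal_mult_top top_unique)
    then show "average M Q (dual_weight p w) < top" using p by (simp add: ennpowr_eq_top_iff less_top)
  qed (use Q in auto)
  let ?W = "emeasure (density M w) Q" and ?S = "emeasure (density M (dual_weight p w)) Q" and ?m = "emeasure M Q"
  show "?W * ennpowr ?S (p - 1) \<le> ennreal c * ennpowr ?m p"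
  proof (cases "?m = 0")
    case True then show ?thesis using density_null[of w Q] Q by simp
  next
    case False
    then have m: "?m \<noteq> 0" "?m \<noteq> top" using finite_basis[OF Q] by auto
    have "?W * ennpowr ?S (p - 1) = (?m * (?W / ?m)) * ennpowr (?m * (?S / ?m)) (p - 1)"
      by (simp only: ennreal_mult_divide_cancel[OF m])
    also have "\<dots> = (?W / ?m * ennpowr (?S / ?m) (p - 1)) * (ennpowr ?m 1 * ennpowr ?m (p - 1))"
      using p by (simp add: ennpowr_mult ennpowr_one ac_simps)
    also have "\<dots> = (?W / ?m * ennpowr (?S / ?m) (p - 1)) * ennpowr ?m p"
      using ennpowr_add[of 1 "p - 1" ?m] p by simp
    also have "\<dots> \<le> ennreal c * ennpowr ?m p"
      using bound Q by (intro mult_right_mono) (auto simp: average_eq_density)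
    finally show ?thesis .
  qed
qed

end

section \<open>Parabolic boxes\<close>

text \<open>The shift by the endpoint keeps the box of parameter \<open>L\<close> inside the domain.\<close>

definition star_center ::
    "nat \<Rightarrow> (nat \<Rightarrow> nat) \<Rightarrow> (nat \<Rightarrow> real set) \<Rightarrow> real \<Rightarrow> (nat \<Rightarrow> real) \<Rightarrow> nat \<Rightarrow> real" where
  "star_center d k I L x = (\<lambda>j\<in>{..<d}. if I j = UNIV then x j else max (x j) (Inf (I j) + L ^ k j / 2))"

lemma greaterThanLessThan_subset_half_line:
  fixes u v :: real
  assumes "J = UNIV \<or> (\<exists>a. J = {a..})" "u < v"
  shows "{u<..<v} \<subseteq> J \<longleftrightarrow> J = UNIV \<or> Inf J \<le> u"
proof (cases "J = UNIV")
  case False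
  then obtain a where J: "J = {a..}" using assms(1) by auto
  have "a \<le> u" if "{u<..<v} \<subseteq> {a..}"
  proof (rule ccontr)
    assume "\<not> a \<le> u"
    \<comment> \<open>The minimum with \<open>v\<close> keeps the midpoint inside the interval even
      when \<open>a\<close> lies beyond it.\<close>
    then have "(u + min a v) / 2 \<in> {u<..<v}" "(u + min a v) / 2 < a"
      using assms(2) by (auto simp: min_def field_simps)
    moreover from this(1) have "(u + min a v) / 2 \<in> {a..}" by (rule subsetD[OF that])
    ultimately show False by simp
  qed
  moreover have "{u<..<v} \<subseteq> {a..}" if "a \<le> u" using that by auto
  ultimately show ?thesis using False unfolding J cInf_atLeast by blast
qed simp

lemma centered_box_ne: "l > 0 \<Longrightarrow> centered_box d k l x \<noteq> {}"
  by (auto simp: centered_box_def PiE_eq_empty_iff not_le)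

lemma centered_box_subset_iff:
  assumes "l > 0"
  shows "centered_box d k l x \<subseteq> (\<Pi>\<^sub>E j\<in>{..<d}. J j) \<longleftrightarrow>
    (\<forall>j<d. {x j - l ^ k j / 2 <..< x j + l ^ k j / 2} \<subseteq> J j)"
  using centered_box_ne[OF assms, of d k x] unfolding centered_box_def
  by (subst subset_PiE) auto

locale admissible_setting =
  fixes d :: nat and k :: "nat \<Rightarrow> nat" and I :: "nat \<Rightarrow> real set" and \<mu> :: "(nat \<Rightarrow> real) measure" and N0 :: real
  assumes adm: "admissible d k I \<mu> N0"
begin

abbreviation "\<Q> \<equiv> boxes d k I"
abbreviation "C \<equiv> centered_box d k"

lemma k_ge: "j < d \<Longrightarrow> k j \<ge> 1"
  and I_cases: "j < d \<Longrightarrow> I j = UNIV \<or> (\<exists>a. I j = {a..})"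
  and space_mu: "space \<mu> = domain d I"
  and sets_mu: "sets \<mu> = sets (restrict_space (\<Pi>\<^sub>M j\<in>{..<d}. (borel :: real measure)) (domain d I))"
  and corner_finite: "x \<in> domain d I \<Longrightarrow> l > 0 \<Longrightarrow> emeasure \<mu> (corner_box d k l x) < \<infinity>"
  and corner_tendsto: "x \<in> domain d I \<Longrightarrow> ((\<lambda>l. emeasure \<mu> (corner_box d k l x)) \<longlongrightarrow> \<infinity>) at_top"
  and boundary_null: "domain_boundary d I \<in> null_sets \<mu>"
  and doubling_mu: "x \<in> domain d I \<Longrightarrow> l > 0 \<Longrightarrow> C l x \<subseteq> domain d I \<Longrightarrow>
        emeasure \<mu> (C (4 * l) x \<inter> domain d I) \<le> ennreal N0 * emeasure \<mu> (C l x)"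
  using adm by (simp_all add: admissible_def)

lemma box_subset_iff:
  assumes "l > 0"
  shows "C l x \<subseteq> domain d I \<longleftrightarrow> (\<forall>j<d. I j = UNIV \<or> Inf (I j) \<le> x j - l ^ k j / 2)"
proof -
  have "{x j - l ^ k j / 2 <..< x j + l ^ k j / 2} \<subseteq> I j \<longleftrightarrow> I j = UNIV \<or> Inf (I j) \<le> x j - l ^ k j / 2"
    if "j < d" for j
    using assms by (intro greaterThanLessThan_subset_half_line[OF I_cases[OF that]]) simp
  then show ?thesis unfolding domain_def centered_box_subset_iff[OF assms] by simp
qed

lemma in_I_iff: "j < d \<Longrightarrow> t \<in> I j \<longleftrightarrow> I j = UNIV \<or> Inf (I j) \<le> t"
proof -
  assume "j < d"
  from I_cases[OF this] show ?thesis
  proof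
    assume "\<exists>a. I j = {a..}"
    then obtain a where "I j = {a..}" ..
    then show ?thesis by (cases "I j = UNIV") simp_all
  qed simp
qed

lemma center_in_domain:
  assumes "x \<in> extensional {..<d}" "l > 0" "C l x \<subseteq> domain d I"
  shows "x \<in> domain d I"
proof -
  have "x j \<in> I j" if "j < d" for j
  proof -
    have "I j = UNIV \<or> Inf (I j) \<le> x j - l ^ k j / 2" using box_subset_iff[of l x] assms that by auto
    moreover have "l ^ k j > 0" using assms by simp
    ultimately show ?thesis unfolding in_I_iff[OF that] by auto
  qed
  then show ?thesis using assms(1) by (auto simp: domain_def PiE_iff)
qed

lemma star_center_subset:
  assumes "l > 0" "L > 0" "C l x \<subseteq> domain d I"
  shows "C L (star_center d k I L x) \<subseteq> domain d I" "star_center d k I L x \<in> domain d I"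
proof -
  show *: "C L (star_center d k I L x) \<subseteq> domain d I"
    using assms by (auto simp: box_subset_iff star_center_def)
  then show "star_center d k I L x \<in> domain d I"
    using assms by (intro center_in_domain) (auto simp: star_center_def)
qed

lemma sets_Int_domain:
  assumes "A \<in> sets (\<Pi>\<^sub>M j\<in>{..<d}. (borel :: real measure))" shows "A \<inter> domain d I \<in> sets \<mu>"
  unfolding sets_mu sets_restrict_space using assms by auto

lemma sets_box_Int_domain: "C l x \<inter> domain d I \<in> sets \<mu>"
  unfolding centered_box_def by (intro sets_Int_domain sets_PiM_I_finite) auto

text \<open>The shifted box of parameter \<open>4 * l\<close> may leave \<open>C (4 * l) x\<close>, so the doubling hypothesis does not
  apply to it directly; the one of parameter \<open>2 * l\<close> does not leave it, and two such steps suffice.\<close>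

lemma double_step:
  assumes x: "x \<in> domain d I" and l: "l > 0" and sub: "C l x \<subseteq> domain d I"
  shows "emeasure \<mu> (C (2 * l) (star_center d k I (2 * l) x)) \<le> ennreal N0 * emeasure \<mu> (C l x)"
proof -
  let ?y = "star_center d k I (2 * l) x"
  have "C (2 * l) ?y \<subseteq> C (4 * l) x"
  proof -
    have "{?y j - (2 * l) ^ k j / 2 <..< ?y j + (2 * l) ^ k j / 2}
        \<subseteq> {x j - (4 * l) ^ k j / 2 <..< x j + (4 * l) ^ k j / 2}" if j: "j < d" for j
    proof -
      have pow: "(4 * l) ^ k j = 2 ^ k j * (2 * l) ^ k j" "(2 * l) ^ k j = 2 ^ k j * l ^ k j"
        using power_mult_distrib[of 2 "2 * l" "k j"] power_mult_distrib[of 2 l "k j"] by simp_all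
      have "(2::real) ^ k j \<ge> 2" using k_ge[OF j] self_le_power[of "2::real" "k j"] by simp
      then have *: "(4 * l) ^ k j \<ge> 2 * (2 * l) ^ k j" "(2 * l) ^ k j \<ge> 2 * l ^ k j" "l ^ k j > 0"
        unfolding pow using l by simp_all
      have "I j = UNIV \<or> Inf (I j) \<le> x j - l ^ k j / 2" using sub box_subset_iff[OF l] j by auto
      then have "I j = UNIV \<or> Inf (I j) \<le> x j" using *(3) by linarith
      \<comment> \<open>The centre rises by at most (2l)^k/2, and (4l)^k/2 >= (2l)^k leaves room for
        that shift plus the half-width.\<close>
      then have "?y j \<ge> x j" "?y j \<le> x j + (2 * l) ^ k j / 2"
        using j l by (auto simp: star_center_def)
      then have "x j - (4 * l) ^ k j / 2 \<le> ?y j - (2 * l) ^ k j / 2"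
        "?y j + (2 * l) ^ k j / 2 \<le> x j + (4 * l) ^ k j / 2"
        using * by linarith+
      then show ?thesis unfolding greaterThanLessThan_subseteq_greaterThanLessThan by blast
    qed
    then show ?thesis using l unfolding centered_box_def[of d k "4 * l"]
      by (subst centered_box_subset_iff) auto
  qed
  then have "emeasure \<mu> (C (2 * l) ?y) \<le> emeasure \<mu> (C (4 * l) x \<inter> domain d I)"
    using star_center_subset[OF l _ sub, of "2 * l"] l sets_box_Int_domain by (intro emeasure_mono) auto
  also have "\<dots> \<le> ennreal N0 * emeasure \<mu> (C l x)" by (rule doubling_mu[OF x l sub])
  finally show ?thesis .
qed

text \<open>The larger threshold of the outer maximum dominates the inner one, so two doubling steps
  end exactly at the enlargement used as star.\<close>

lemma star_center_twice:
  assumes "l > 0"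
  shows "star_center d k I (4 * l) (star_center d k I (2 * l) x) = star_center d k I (4 * l) x"
proof
  fix j
  have "(2 * l) ^ k j \<le> (4 * l) ^ k j" using assms by (intro power_mono) auto
  then show "star_center d k I (4 * l) (star_center d k I (2 * l) x) j = star_center d k I (4 * l) x j"
    by (auto simp: star_center_def max_def)
qed

lemma double_twice:
  assumes x: "x \<in> domain d I" and l: "l > 0" and sub: "C l x \<subseteq> domain d I"
  shows "emeasure \<mu> (C (4 * l) (star_center d k I (4 * l) x)) \<le> ennreal N0 ^ 2 * emeasure \<mu> (C l x)"
proof -
  let ?y = "star_center d k I (2 * l) x"
  have y: "?y \<in> domain d I" "C (2 * l) ?y \<subseteq> domain d I" using star_center_subset[OF l _ sub, of "2 * l"] l by auto
  have "emeasure \<mu> (C (4 * l) (star_center d k I (4 * l) x)) \<le> ennreal N0 * emeasure \<mu> (C (2 * l) ?y)"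
    using double_step[OF y(1) _ y(2)] l star_center_twice[OF l] by simp
  also have "\<dots> \<le> ennreal N0 * (ennreal N0 * emeasure \<mu> (C l x))"
    using double_step[OF x l sub] by (intro mult_left_mono) auto
  finally show ?thesis by (simp add: power2_eq_square mult.assoc)
qed

text \<open>In each coordinate the smaller box stays within 3/2 l^k of \<open>x\<close>, while
  (4l)^k/2 >= 2 l^k. An upward shift only helps above; below, a shifted star starts at the endpoint
  of the domain, which bounds the smaller box too.\<close>

lemma meets_subset_star_box:
  assumes l: "l > 0" "0 < l'" "l' \<le> l" and sub: "C l' x' \<subseteq> domain d I" and meets: "C l x \<inter> C l' x' \<noteq> {}"
  shows "C l' x' \<subseteq> C (4 * l) (star_center d k I (4 * l) x)"
proof -
  let ?y = "star_center d k I (4 * l) x"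
  obtain z where z: "z \<in> C l x" "z \<in> C l' x'" using meets by auto
  have "{x' j - l' ^ k j / 2 <..< x' j + l' ^ k j / 2}
        \<subseteq> {?y j - (4 * l) ^ k j / 2 <..< ?y j + (4 * l) ^ k j / 2}" if j: "j < d" for j
  proof -
    have zj: "x j - l ^ k j / 2 < z j" "z j < x j + l ^ k j / 2"
      "x' j - l' ^ k j / 2 < z j" "z j < x' j + l' ^ k j / 2"
      using z j by (auto simp: centered_box_def PiE_iff)
    have "(4::real) ^ k j \<ge> 4" using k_ge[OF j] self_le_power[of "4::real" "k j"] by simp
    then have 4: "(4 * l) ^ k j \<ge> 4 * l ^ k j" using l by (simp add: power_mult_distrib)
    have pos: "l ^ k j > 0" "l' ^ k j > 0" "l' ^ k j \<le> l ^ k j" using l by (auto intro: power_mono)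
    have "I j = UNIV \<or> Inf (I j) \<le> x' j - l' ^ k j / 2" using sub box_subset_iff[OF l(2)] j by auto
    moreover have "?y j = x j \<or> ?y j = Inf (I j) + (4 * l) ^ k j / 2 \<and> I j \<noteq> UNIV"
      using j by (auto simp: star_center_def max_def)
    ultimately have "?y j - (4 * l) ^ k j / 2 \<le> x' j - l' ^ k j / 2"
      using zj 4 pos by linarith
    moreover have "?y j \<ge> x j" using j by (auto simp: star_center_def)
    then have "x' j + l' ^ k j / 2 \<le> ?y j + (4 * l) ^ k j / 2" using zj 4 pos by linarith
    ultimately show ?thesis unfolding greaterThanLessThan_subseteq_greaterThanLessThan by blast
  qed
  then show ?thesis unfolding centered_box_def[of d k "4 * l"]
    using l by (subst centered_box_subset_iff) auto
qed

section \<open>Measurability, finiteness and countable subcovers of boxes\<close>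

lemma sets_boxes:
  assumes "Q \<in> \<Q>" shows "Q \<in> sets \<mu>"
proof -
  obtain l x where "Q = C l x" "C l x \<subseteq> domain d I" using assms by (auto simp: boxes_def)
  then show ?thesis using sets_box_Int_domain[of l x] by (simp add: Int_absorb2)
qed

lemma emeasure_box_less_top:
  assumes "Q \<in> \<Q>" shows "emeasure \<mu> Q < top"
proof -
  obtain l x where Q: "Q = C l x" "l > 0" "C l x \<subseteq> domain d I" using assms by (auto simp: boxes_def)
  \<comment> \<open>Finiteness is assumed for half-open boxes attached to a corner; the lower corner
    of an open box inside the domain still lies in the closed domain.\<close>
  define y where "y = (\<lambda>j\<in>{..<d}. x j - l ^ k j / 2)"
  have yI: "y j \<in> I j" if "j < d" for j
    using Q box_subset_iff[of l x] that by (auto simp: y_def in_I_iff)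
  then have y: "y \<in> domain d I" by (simp add: domain_def PiE_iff) (simp add: y_def)
  have "{y j ..< y j + l ^ k j} \<subseteq> I j" if "j < d" for j
    using yI[OF that] by (auto simp: in_I_iff[OF that])
  then have "corner_box d k l y \<subseteq> domain d I"
    unfolding corner_box_def domain_def by (intro PiE_mono) auto
  moreover have "corner_box d k l y \<inter> domain d I \<in> sets \<mu>"
    unfolding corner_box_def by (intro sets_Int_domain sets_PiM_I_finite) auto
  ultimately have "corner_box d k l y \<in> sets \<mu>" by (simp add: Int_absorb2)
  moreover have "C l x \<subseteq> corner_box d k l y"
    unfolding corner_box_def using Q(2) by (subst centered_box_subset_iff) (auto simp: y_def)
  ultimately have "emeasure \<mu> Q \<le> emeasure \<mu> (corner_box d k l y)" unfolding Q(1) by (intro emeasure_mono)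
  also have "\<dots> < top" using corner_finite[OF y Q(2)] by simp
  finally show ?thesis .
qed

text \<open>Leaving coordinates beyond \<open>d\<close> free gives an open product in the second
  countable space \<open>nat \<Rightarrow> real\<close>, so Lindelof's theorem applies relative to
  the extensional functions.\<close>

lemma openin_centered_box: "openin (top_of_set (extensional {..<d})) (C l x)"
proof -
  define X where "X j = (if j < d then {x j - l ^ k j / 2 <..< x j + l ^ k j / 2} else UNIV)" for j
  have "{j. X j \<noteq> UNIV} \<subseteq> {..<d}" by (auto simp: X_def)
  then have "open (Pi\<^sub>E UNIV X)"
    by (intro open_PiE) (auto simp: X_def intro: finite_subset)
  moreover have "C l x = extensional {..<d} \<inter> Pi\<^sub>E UNIV X"
    unfolding centered_box_def X_def by (auto simp: PiE_def Pi_def split: if_splits)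
  ultimately show ?thesis by (metis openin_open_Int)
qed

lemma countable_subcover_boxes:
  assumes "\<A> \<subseteq> \<Q>" shows "\<exists>\<C>\<subseteq>\<A>. countable \<C> \<and> \<Union>\<C> = \<Union>\<A>"
proof -
  have "openin (top_of_set (extensional {..<d})) Q" if "Q \<in> \<A>" for Q
    using that assms openin_centered_box by (auto simp: boxes_def)
  then show ?thesis
    using Lindelof_openin[of \<A> "extensional {..<d}"] by metis
qed

lemma not_boundary_imp_above:
  assumes x: "x \<in> domain d I" "x \<notin> domain_boundary d I" and j: "j < d" "I j \<noteq> UNIV"
  shows "Inf (I j) < x j"
proof -
  let ?X = "product_topology (\<lambda>_. euclideanreal) {..<d}"
  have "domain d I \<subseteq> topspace ?X" by (auto simp: domain_def PiE_iff)
  then have "x \<in> ?X interior_of domain d I"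
    using x closure_of_subset[of "domain d I" ?X] by (auto simp: domain_boundary_def frontier_of_def)
  then obtain T where T: "openin ?X T" "x \<in> T" "T \<subseteq> domain d I" by (auto simp: interior_of_def)
  obtain U where U: "\<And>i. i < d \<Longrightarrow> open (U i)" "x \<in> Pi\<^sub>E {..<d} U" "Pi\<^sub>E {..<d} U \<subseteq> T"
  proof -
    from bspec[OF T(1)[unfolded openin_product_topology_alt] T(2)]
    obtain U where "\<forall>i\<in>{..<d}. openin euclideanreal (U i)" "x \<in> Pi\<^sub>E {..<d} U" "Pi\<^sub>E {..<d} U \<subseteq> T"
      by (elim exE conjE) (rule that)
    then show ?thesis by (intro that[of U]) auto
  qed
  have "Pi\<^sub>E {..<d} U \<subseteq> Pi\<^sub>E {..<d} I"
    using U(3) T(3) unfolding domain_def by (rule subset_trans)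
  then have "U j \<subseteq> I j"
    using U(2) j(1) by (auto simp: subset_PiE)
  moreover have "x j \<in> U j" using U(2) j by (auto simp: PiE_iff)
  ultimately obtain e where e: "e > 0" "ball (x j) e \<subseteq> I j" using U(1)[OF j(1)] by (meson open_contains_ball subset_trans)
  then have "x j - e / 2 \<in> I j" by (auto simp: dist_real_def)
  then show ?thesis using e(1) j(2) unfolding in_I_iff[OF j(1)] by linarith
qed

lemma domain_subset_boxes: "domain d I \<subseteq> \<Union>\<Q> \<union> domain_boundary d I"
proof
  fix x assume x: "x \<in> domain d I"
  show "x \<in> \<Union>\<Q> \<union> domain_boundary d I"
  proof (cases "x \<in> domain_boundary d I")
    case False
    \<comment> \<open>The element 1 makes the set nonempty and forces l <= 1, hence l^k <= l: one
      scale then fits in all coordinates despite different exponents.\<close>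
    let ?S = "insert 1 ((\<lambda>j. x j - Inf (I j)) ` {j. j < d \<and> I j \<noteq> UNIV})"
    define l where "l = Min ?S"
    have "l \<in> ?S" unfolding l_def by (intro Min_in) auto
    then have "l = 1 \<or> (\<exists>j<d. I j \<noteq> UNIV \<and> l = x j - Inf (I j))" by auto
    then have l: "l > 0" using not_boundary_imp_above[OF x False] by fastforce
    have l1: "l \<le> 1" and lj: "\<And>j. j < d \<Longrightarrow> I j \<noteq> UNIV \<Longrightarrow> l \<le> x j - Inf (I j)"
      unfolding l_def by (auto intro!: Min_le)
    have "C l x \<subseteq> domain d I" unfolding box_subset_iff[OF l]
    proof (intro allI impI)
      fix j assume j: "j < d"
      have "l ^ k j \<le> l ^ 1" using l l1 k_ge[OF j] by (intro power_decreasing) auto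
      then show "I j = UNIV \<or> Inf (I j) \<le> x j - l ^ k j / 2" using lj[OF j] l by fastforce
    qed
    moreover have "x \<in> C l x" using x l by (auto simp: centered_box_def domain_def PiE_iff)
    ultimately show ?thesis using x l by (auto simp: boxes_def)
  qed simp
qed

text \<open>Otherwise countably many null boxes and the null boundary would exhaust the domain,
  contradicting that the measures of growing corner boxes tend to infinity.\<close>

lemma ex_box_emeasure_nonzero: "\<exists>Q\<in>\<Q>. emeasure \<mu> Q \<noteq> 0"
proof (rule ccontr)
  assume "\<not> ?thesis"
  then have null: "Q \<in> null_sets \<mu>" if "Q \<in> \<Q>" for Q using that sets_boxes by auto
  obtain \<C> where \<C>: "\<C> \<subseteq> \<Q>" "countable \<C>" "\<Union>\<C> = \<Union>\<Q>" using countable_subcover_boxes[of \<Q>] by auto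
  then have "(\<Union>Q\<in>\<C>. Q) \<in> null_sets \<mu>" using null by (intro null_sets_UN') auto
  then have "\<Union>\<Q> \<union> domain_boundary d I \<in> null_sets \<mu>" using \<C>(3) boundary_null by (intro null_sets.Un) simp
  then have "emeasure \<mu> (space \<mu>) = 0"
    using domain_subset_boxes unfolding space_mu[symmetric]
    by (metis emeasure_mono le_zero_eq null_setsD1 null_setsD2)
  then have zero: "emeasure \<mu> A = 0" for A by (metis emeasure_space le_zero_eq)
  \<comment> \<open>A sample point of the domain; on a full line \<open>Inf (I j)\<close> is just
    some real number.\<close>
  let ?x = "\<lambda>j\<in>{..<d}. Inf (I j)"
  have "?x \<in> domain d I" by (auto simp: domain_def PiE_iff in_I_iff)
  from corner_tendsto[OF this] have "((\<lambda>l::real. 0::ennreal) \<longlongrightarrow> \<infinity>) at_top" unfolding zero .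
  then have "(\<infinity>::ennreal) = 0" by (simp add: tendsto_const_iff)
  then show False by simp
qed

section \<open>Boxes as a doubling basis\<close>

definition box_size :: "(nat \<Rightarrow> real) set \<Rightarrow> real" where
  "box_size Q = (SOME l. l > 0 \<and> (\<exists>x\<in>domain d I. Q = C l x))"

text \<open>The abstract setting wants a function of the set alone, so a scale and a centre are
  chosen for each box.\<close>

definition box_star :: "(nat \<Rightarrow> real) set \<Rightarrow> (nat \<Rightarrow> real) set" where
  "box_star Q = C (4 * box_size Q)
     (star_center d k I (4 * box_size Q) (SOME x. x \<in> domain d I \<and> Q = C (box_size Q) x))"

lemma box_representation:
  assumes "Q \<in> \<Q>"
  obtains x where "box_size Q > 0" "x \<in> domain d I" "Q = C (box_size Q) x" "C (box_size Q) x \<subseteq> domain d I"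
    "box_star Q = C (4 * box_size Q) (star_center d k I (4 * box_size Q) x)"
proof -
  have "\<exists>l. l > 0 \<and> (\<exists>x\<in>domain d I. Q = C l x)" and sub: "Q \<subseteq> domain d I" using assms by (auto simp: boxes_def)
  from someI_ex[OF this(1)] have *: "box_size Q > 0" "\<exists>x. x \<in> domain d I \<and> Q = C (box_size Q) x"
    unfolding box_size_def[symmetric] by auto
  from someI_ex[OF *(2)] show ?thesis
    using sub by (intro that[OF *(1)]) (auto simp: box_star_def)
qed

lemma doubling_basis_boxes: "doubling_basis \<mu> \<Q> box_size box_star (ennreal N0 ^ 2)"
proof
  show "\<Q> \<subseteq> sets \<mu>" using sets_boxes by auto
  show "\<exists>\<C>\<subseteq>\<A>. countable \<C> \<and> \<Union>\<C> = \<Union>\<A>" if "\<A> \<subseteq> \<Q>" for \<A>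
    using that by (rule countable_subcover_boxes)
  show "emeasure \<mu> Q < top" if "Q \<in> \<Q>" for Q using that by (rule emeasure_box_less_top)
  fix Q assume Q: "Q \<in> \<Q>"
  obtain x where x: "box_size Q > 0" "x \<in> domain d I" "Q = C (box_size Q) x" "C (box_size Q) x \<subseteq> domain d I"
    "box_star Q = C (4 * box_size Q) (star_center d k I (4 * box_size Q) x)"
    using box_representation[OF Q] .
  show "box_star Q \<in> \<Q>"
    using star_center_subset[of "box_size Q" "4 * box_size Q" x] x(1,4) unfolding x(5) boxes_def by force
  show "emeasure \<mu> (box_star Q) \<le> ennreal N0 ^ 2 * emeasure \<mu> Q"
    using double_twice[OF x(2,1,4)] unfolding x(5) using x(3) by simp
  fix Q' assume Q': "Q' \<in> \<Q>" "box_size Q' \<le> box_size Q" "Q \<inter> Q' \<noteq> {}"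
  obtain x' where x': "box_size Q' > 0" "Q' = C (box_size Q') x'" "C (box_size Q') x' \<subseteq> domain d I"
    using box_representation[OF Q'(1)] .
  have "C (box_size Q) x \<inter> C (box_size Q') x' \<noteq> {}" using Q'(3) x(3) x'(2) by simp
  from meets_subset_star_box[OF x(1) x'(1) Q'(2) x'(3) this] show "Q' \<subseteq> box_star Q"
    unfolding x(5) using x'(2) by simp
qed

end

section \<open>The maximal theorem\<close>

text \<open>The constant \<open>K * ennpowr D p * K\<close> of the weighted weak bound with
  \<open>K = c\<close> and \<open>D = N0^2\<close>.\<close>

definition weak_const :: "real \<Rightarrow> real \<Rightarrow> real \<Rightarrow> ennreal" where
  "weak_const p N0 c = ennreal c * ennpowr (ennreal N0 ^ 2) p * ennreal c"

context admissible_setting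
begin

lemma A_weight_consequences:
  assumes p: "1 \<le> p" and w: "A_weight p \<mu> \<Q> w"
  shows "A_bound p \<mu> \<Q> w (A_const p \<mu> \<Q> w)" "is_weight \<mu> \<Q> w" "w \<in> borel_measurable \<mu>"
    "Q \<in> \<Q> \<Longrightarrow> average \<mu> Q w < top"
  using doubling_basis.A_bound_A_const[OF doubling_basis_boxes p w] ex_box_emeasure_nonzero w
  by (auto simp: A_weight_def is_weight_def)

lemma maximal_weak_type:
  fixes f :: "(nat \<Rightarrow> real) \<Rightarrow> real"
  assumes p: "1 \<le> p" and w: "A_weight p \<mu> \<Q> w" and t: "0 < t"
    and f: "f \<in> borel_measurable \<mu>" "\<forall>x\<in>domain d I. 0 \<le> f x"
  shows "{x \<in> domain d I. maximal \<mu> \<Q> f x > ennreal t} \<in> sets \<mu> \<and>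
         emeasure (density \<mu> w) {x \<in> domain d I. maximal \<mu> \<Q> f x > ennreal t}
           \<le> ennreal (enn2real (weak_const p N0 (A_const p \<mu> \<Q> w)) * t powr (- p))
              * (\<integral>\<^sup>+x. ennreal (f x powr p) \<partial>density \<mu> w)"
proof -
  interpret doubling_basis \<mu> \<Q> box_size box_star "ennreal N0 ^ 2" by (rule doubling_basis_boxes)
  define c where "c = A_const p \<mu> \<Q> w"
  note A = A_weight_consequences[OF p w, folded c_def]
  have bound: "Muckenhoupt_bound p (ennreal c) w"
  proof (cases "p = 1")
    case True then show ?thesis using Muckenhoupt_bound_1[OF A(2)] A(1) by simp
  next
    case False
    then interpret Muckenhoupt_weight \<mu> \<Q> box_size box_star "ennreal N0 ^ 2" p w "ennreal c"
      using p by (intro Muckenhoupt_weight_A_bound[OF _ A(2,1)]) auto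
    show ?thesis by (rule Muckenhoupt_bound)
  qed
  have fin: "emeasure (density \<mu> w) Q < top" if "Q \<in> \<Q>" for Q
    by (rule emeasure_density_less_top[OF A(3) that A(4)[OF that]])
  let ?g = "\<lambda>x. ennreal \<bar>f x\<bar>"
  have g: "?g \<in> borel_measurable \<mu>" using f(1) by measurable
  \<comment> \<open>Finiteness ensures that turning the constant into a real number does not
    collapse it to 0, the value of \<open>enn2real\<close> at \<open>top\<close>.\<close>
  have "weak_const p N0 c < top"
    using p by (auto simp: weak_const_def ennreal_mult_less_top ennpowr_less_top power_less_top_ennreal)
  then have N: "ennreal (enn2real (weak_const p N0 c)) = weak_const p N0 c" by simp
  have int: "(\<integral>\<^sup>+x. ennpowr (?g x) p \<partial>density \<mu> w) = (\<integral>\<^sup>+x. ennreal (f x powr p) \<partial>density \<mu> w)"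
    using f(2) p by (intro nn_integral_cong) (auto simp: space_mu ennpowr_ennreal)
  have set: "{x \<in> domain d I. maximal \<mu> \<Q> f x > ennreal t} = {x \<in> space \<mu>. ennreal t < maximal_op \<mu> \<Q> ?g x}"
    by (simp add: space_mu maximal_eq_maximal_op)
  show ?thesis
    using weighted_weak_type[OF A(3) _ bound fin g t, folded weak_const_def] p
    unfolding set c_def[symmetric] int
    by (auto simp: ennreal_mult N)
qed

lemma maximal_strong_type:
  assumes p: "1 < p" and w: "A_weight p \<mu> \<Q> w" and f: "f \<in> Lp_space p (density \<mu> w)"
  shows "maximal \<mu> \<Q> f \<in> borel_measurable (density \<mu> w) \<and>
         Lp_norm p (density \<mu> w) (maximal \<mu> \<Q> f)
           \<le> ennreal (enn2real (ennpowr (strong_const p (ennreal (A_const p \<mu> \<Q> w)) (ennreal N0 ^ 2)) (1 / p)))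
              * Lp_norm p (density \<mu> w) (\<lambda>x. ennreal \<bar>f x\<bar>)"
proof -
  interpret doubling_basis \<mu> \<Q> box_size box_star "ennreal N0 ^ 2" by (rule doubling_basis_boxes)
  define c where "c = A_const p \<mu> \<Q> w"
  note A = A_weight_consequences[OF less_imp_le[OF p] w, folded c_def]
  interpret Muckenhoupt_weight \<mu> \<Q> box_size box_star "ennreal N0 ^ 2" p w "ennreal c"
    by (rule Muckenhoupt_weight_A_bound[OF p A(2,1)])
  let ?g = "\<lambda>x. ennreal \<bar>f x\<bar>" and ?B = "strong_const p (ennreal c) (ennreal N0 ^ 2)"
  have "f \<in> borel_measurable \<mu>" using f by (simp add: Lp_space_def measurable_density_eq1)
  then have g: "?g \<in> borel_measurable \<mu>" by measurable
  have B: "?B < top"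
    using p by (intro strong_const_less_top) (auto simp: power_less_top_ennreal)
  then have "ennpowr ?B (1 / p) < top"
    using p by (intro ennpowr_less_top) auto
  then have N: "ennreal (enn2real (ennpowr ?B (1 / p))) = ennpowr ?B (1 / p)" by simp
  have "Lp_norm p (density \<mu> w) (maximal \<mu> \<Q> f) \<le> ennpowr (?B * (\<integral>\<^sup>+x. ennpowr (?g x) p \<partial>density \<mu> w)) (1 / p)"
    unfolding Lp_norm_def maximal_eq_maximal_op
    using weighted_strong_type[OF g] p by (intro ennpowr_mono) auto
  also have "\<dots> = ennpowr ?B (1 / p) * Lp_norm p (density \<mu> w) ?g"
    using p by (simp add: ennpowr_mult Lp_norm_def)
  finally show ?thesis
    using measurable_maximal_op unfolding c_def[symmetric] N maximal_eq_maximal_op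
    by (simp add: measurable_density_eq1)
qed

end

theorem theorem5p3:
  shows
  "(\<exists>N :: real \<Rightarrow> real \<Rightarrow> real \<Rightarrow> real.
      \<forall>(p::real) (N0::real) (d::nat) (k :: nat \<Rightarrow> nat) (I :: nat \<Rightarrow> real set)
        (\<mu> :: (nat \<Rightarrow> real) measure) (w :: (nat \<Rightarrow> real) \<Rightarrow> ennreal).
        1 \<le> p \<longrightarrow> admissible d k I \<mu> N0 \<longrightarrow> A_weight p \<mu> (boxes d k I) w \<longrightarrow>
        (\<forall>(t::real) (f :: (nat \<Rightarrow> real) \<Rightarrow> real).
           0 < t \<longrightarrow> f \<in> borel_measurable \<mu> \<longrightarrow> (\<forall>x\<in>domain d I. 0 \<le> f x) \<longrightarrow>
           {x \<in> domain d I. maximal \<mu> (boxes d k I) f x > ennreal t} \<in> sets \<mu> \<and>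
           emeasure (density \<mu> w) {x \<in> domain d I. maximal \<mu> (boxes d k I) f x > ennreal t}
             \<le> ennreal (N p N0 (A_const p \<mu> (boxes d k I) w) * t powr (- p))
                * (\<integral>\<^sup>+x. ennreal (f x powr p) \<partial>density \<mu> w)))
   \<and>
   (\<exists>N :: real \<Rightarrow> real \<Rightarrow> real \<Rightarrow> real.
      \<forall>(p::real) (N0::real) (d::nat) (k :: nat \<Rightarrow> nat) (I :: nat \<Rightarrow> real set)
        (\<mu> :: (nat \<Rightarrow> real) measure) (w :: (nat \<Rightarrow> real) \<Rightarrow> ennreal).
        1 < p \<longrightarrow> admissible d k I \<mu> N0 \<longrightarrow> A_weight p \<mu> (boxes d k I) w \<longrightarrow>
        (\<forall>f \<in> Lp_space p (density \<mu> w).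
           maximal \<mu> (boxes d k I) f \<in> borel_measurable (density \<mu> w) \<and>
           Lp_norm p (density \<mu> w) (maximal \<mu> (boxes d k I) f)
             \<le> ennreal (N p N0 (A_const p \<mu> (boxes d k I) w))
                * Lp_norm p (density \<mu> w) (\<lambda>x. ennreal \<bar>f x\<bar>)))"
proof (rule conjI, goal_cases)
  \<comment> \<open>The witness is a function of \<open>p\<close>, \<open>N0\<close> and the weight
    constant fixed before \<open>d\<close>, \<open>k\<close>, \<open>I\<close>, \<mu> and
    \<open>w\<close> are introduced, which gives the required uniformity.\<close>
  case 1
  show ?case
    by (intro exI[of _ "\<lambda>p N0 c. enn2real (weak_const p N0 c)"] allI impI,
        rule admissible_setting.maximal_weak_type[OF admissible_setting.intro])
next
  case 2
  show ?case
    by (intro exI[of _ "\<lambda>p N0 c. enn2real (ennpowr (strong_const p (ennreal c) (ennreal N0 ^ 2)) (1 / p))"]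
          allI impI ballI,
        rule admissible_setting.maximal_strong_type[OF admissible_setting.intro])
qed

end
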